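(* For every $d\in\mathbb{N}$, we have \[ \overline{\operatorname{asdim}}_{\mathrm{poly}(d)}\mathbb{H}^2 = 2. \]
   Context: $\mathbb{H}^2$ is the hyperbolic plane (replaced by a maximal $1$-separated subset). $\overline{\operatorname{asdim}}_{\mathrm{poly}(d)}(X)$ is the least $n$ such that for every $r\geq0$, $X=X_0\cup\dots\cup X_n$ with each $X_i$ a disjoint union of pieces pairwise at distance at least $r$, such that, writing $\mathcal Y$ for the family of all pieces, for all $m,s\geq 1$ the family $N^m_s(\mathcal Y)=\{N^m_s(Y)\}$ has uniform growth at most $C\rho^d+C$ (for some $C$ depending on $m,s$). Here $N^0_s(Y)=Y$ and $N^{k+1}_s(Y)$ is the union of all $Y'\in\mathcal Y$ intersecting the closed $s$-neighbourhood of $N^k_s(Y)$. *)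

theory Defs
  imports Complex_Main
begin

definition H2 :: "complex set" where
  "H2 = {z. Im z > 0}"

definition hdist :: "complex \<Rightarrow> complex \<Rightarrow> real" where
  "hdist z w = arcosh (1 + (cmod (z - w))\<^sup>2 / (2 * Im z * Im w))"

definition separated :: "('a \<Rightarrow> 'a \<Rightarrow> real) \<Rightarrow> real \<Rightarrow> 'a set \<Rightarrow> bool" where
  "separated \<delta> t X \<longleftrightarrow> (\<forall>x\<in>X. \<forall>y\<in>X. x \<noteq> y \<longrightarrow> \<delta> x y \<ge> t)"

definition maximal_separated_H2 :: "complex set \<Rightarrow> bool" where
  "maximal_separated_H2 X \<longleftrightarrow> X \<subseteq> H2 \<and> separated hdist 1 X \<and>
     (\<forall>z\<in>H2 - X. \<not> separated hdist 1 (insert z X))"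

definition nbhd :: "('a \<Rightarrow> 'a \<Rightarrow> real) \<Rightarrow> 'a set \<Rightarrow> real \<Rightarrow> 'a set \<Rightarrow> 'a set" where
  "nbhd \<delta> X s A = {x\<in>X. \<exists>y\<in>A. \<delta> x y \<le> s}"

fun iter_nbhd :: "('a \<Rightarrow> 'a \<Rightarrow> real) \<Rightarrow> 'a set \<Rightarrow> 'a set set \<Rightarrow> real \<Rightarrow> nat \<Rightarrow> 'a set \<Rightarrow> 'a set" where
  "iter_nbhd \<delta> X \<Y> s 0 Y = Y"
| "iter_nbhd \<delta> X \<Y> s (Suc k) Y =
     \<Union>{Y'\<in>\<Y>. Y' \<inter> nbhd \<delta> X s (iter_nbhd \<delta> X \<Y> s k Y) \<noteq> {}}"

definition uniform_growth_le :: "('a \<Rightarrow> 'a \<Rightarrow> real) \<Rightarrow> 'a set set \<Rightarrow> (real \<Rightarrow> real) \<Rightarrow> bool" where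
  "uniform_growth_le \<delta> \<F> f \<longleftrightarrow>
     (\<forall>Z\<in>\<F>. \<forall>x\<in>Z. \<forall>\<rho>\<ge>0. finite {z\<in>Z. \<delta> x z \<le> \<rho>} \<and>
         real (card {z\<in>Z. \<delta> x z \<le> \<rho>}) \<le> f \<rho>)"

definition asdim_poly_property :: "('a \<Rightarrow> 'a \<Rightarrow> real) \<Rightarrow> 'a set \<Rightarrow> nat \<Rightarrow> nat \<Rightarrow> bool" where
  "asdim_poly_property \<delta> X d n \<longleftrightarrow>
    (\<forall>r::real\<ge>0. \<exists>\<U> :: nat \<Rightarrow> 'a set set.
       X = (\<Union>i\<le>n. \<Union>(\<U> i)) \<and>
       (\<forall>i\<le>n. \<forall>Y\<in>\<U> i. \<forall>Y'\<in>\<U> i. Y \<noteq> Y' \<longrightarrow>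
           Y \<inter> Y' = {} \<and> (\<forall>y\<in>Y. \<forall>y'\<in>Y'. \<delta> y y' \<ge> r)) \<and>
       (let \<Y> = (\<Union>i\<le>n. \<U> i) in
         \<forall>m::nat. \<forall>s::real. m \<ge> 1 \<longrightarrow> s \<ge> 1 \<longrightarrow>
           (\<exists>C::real. uniform_growth_le \<delta> ((\<lambda>Y. iter_nbhd \<delta> X \<Y> s m Y) ` \<Y>)
                        (\<lambda>\<rho>. C * \<rho> ^ d + C))))"

definition asdim_poly :: "('a \<Rightarrow> 'a \<Rightarrow> real) \<Rightarrow> 'a set \<Rightarrow> nat \<Rightarrow> nat" where
  "asdim_poly \<delta> X d = (LEAST n. asdim_poly_property \<delta> X d n)"

end

theory Submission
  imports Defs "HOL-Analysis.Analysis"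
begin

text \<open>
  Upper bound: cut the half-plane into horizontal layers of height ratio \<open>n\<close> and each layer into
  bricks. Neighbourhoods of the vertices, of the edges and of the faces of this tiling give three
  families of uniformly bounded, \<open>r\<close>-disjoint pieces; iterated neighbourhoods of bounded pieces are
  bounded, so their growth is bounded too.

  Lower bound: suppose two families suffice. A chain of a single piece that stays below height \<open>H\<close>
  has horizontal extent at most \<open>N * H\<close>, because a longer one would contain exponentially many
  points seen from its highest point. Hence, by a Hex argument, in every box of height \<open>h\<close> and width
  of order \<open>h\<close> some piece runs from the bottom to the top; call this a leg of height \<open>h\<close>. At every
  scale \<open>t \<le> h\<close> a leg of height \<open>h\<close> passes above its foot at height about \<open>t\<close>, so a leg of height
  \<open>t\<close> standing at horizontal distance about \<open>t\<close> belongs to its \<open>s\<close>-neighbourhood, with \<open>s\<close>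
  independent of \<open>t\<close>. Iterating \<open>m\<close> times, the \<open>m\<close>-th neighbourhood of a leg of height \<open>R ^ L\<close>
  has at least \<open>L choose m\<close> points near height \<open>1\<close>, all at distance \<open>O(L)\<close> from the foot. For
  \<open>m = d + 1\<close> this exceeds growth of degree \<open>d\<close>.
\<close>

section \<open>Hyperbolic distance through its hyperbolic cosine\<close>

text \<open>On \<open>H2\<close> this is \<open>2 * (cosh (hdist z w) - 1)\<close>. Being rational
  in the coordinates, it replaces the distance in all estimates.\<close>

definition hq :: "complex \<Rightarrow> complex \<Rightarrow> real" where
  "hq z w = (cmod (z - w))\<^sup>2 / (Im z * Im w)"

lemma hq_self [simp]: "hq z z = 0"
  by (simp add: hq_def)

lemma hq_commute: "hq z w = hq w z"
  by (simp add: hq_def norm_minus_commute mult.commute)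

lemma hdist_commute: "hdist z w = hdist w z"
  by (simp add: hdist_def norm_minus_commute mult.commute mult.left_commute)

lemma hdist_hq: "hdist z w = arcosh (1 + hq z w / 2)"
  by (simp add: hdist_def hq_def mult_ac)

lemma hdist_self [simp]: "hdist z z = 0"
  by (simp add: hdist_hq)

lemma H2_Im_pos: "z \<in> H2 \<Longrightarrow> Im z > 0"
  by (simp add: H2_def)

lemma hq_nonneg: "z \<in> H2 \<Longrightarrow> w \<in> H2 \<Longrightarrow> hq z w \<ge> 0"
  by (simp add: hq_def H2_def)

lemma hdist_nonneg: "z \<in> H2 \<Longrightarrow> w \<in> H2 \<Longrightarrow> hdist z w \<ge> 0"
  using hq_nonneg[of z w] by (simp add: hdist_hq)

lemma hdist_le_iff:
  assumes "z \<in> H2" "w \<in> H2" "\<rho> \<ge> 0"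
  shows "hdist z w \<le> \<rho> \<longleftrightarrow> hq z w \<le> 2 * (cosh \<rho> - 1)"
proof -
  have "hdist z w \<le> \<rho> \<longleftrightarrow> cosh (hdist z w) \<le> cosh \<rho>"
    using cosh_real_nonneg_le_iff[of "hdist z w" \<rho>] hdist_nonneg[of z w] assms by simp
  also have "cosh (hdist z w) = 1 + hq z w / 2"
    using hq_nonneg[of z w] assms by (simp add: hdist_hq)
  finally show ?thesis by (auto simp: field_simps)
qed

lemma hdist_less_iff:
  assumes "z \<in> H2" "w \<in> H2" "\<rho> \<ge> 0"
  shows "hdist z w < \<rho> \<longleftrightarrow> hq z w < 2 * (cosh \<rho> - 1)"
proof -
  have "hdist z w < \<rho> \<longleftrightarrow> cosh (hdist z w) < cosh \<rho>"
    using cosh_real_nonneg_less_iff[of "hdist z w" \<rho>] hdist_nonneg[of z w] assms by simp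
  also have "cosh (hdist z w) = 1 + hq z w / 2"
    using hq_nonneg[of z w] assms by (simp add: hdist_hq)
  finally show ?thesis by (auto simp: field_simps)
qed

lemma hdist_le_arcosh:
  assumes "z \<in> H2" "w \<in> H2" "hq z w \<le> K"
  shows "hdist z w \<le> arcosh (1 + K / 2)"
proof -
  have "K \<ge> 0" using hq_nonneg[of z w] assms by linarith
  then show ?thesis using assms by (simp add: hdist_le_iff)
qed

text \<open>Expanding \<open>(Im z - Im w)^2 \<le> K * Im z * Im w\<close> and dropping
  \<open>(Im z)^2\<close> leaves a common factor \<open>Im w\<close> to cancel.\<close>

lemma hq_Im_le:
  assumes "z \<in> H2" "w \<in> H2" "hq z w \<le> K"
  shows "Im w \<le> (K + 2) * Im z"
proof -
  have pos: "Im z > 0" "Im w > 0" using assms by (auto simp: H2_def)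
  have K: "K \<ge> 0" using hq_nonneg[of z w] assms by linarith
  have "(Im z - Im w)\<^sup>2 \<le> (cmod (z - w))\<^sup>2"
    using abs_Im_le_cmod[of "z - w"] power_mono[of "\<bar>Im z - Im w\<bar>" "cmod (z - w)" 2] by simp
  also have "\<dots> \<le> K * (Im z * Im w)"
    using assms pos by (simp add: hq_def field_simps)
  finally have "Im w * Im w \<le> ((K + 2) * Im z) * Im w"
    using zero_le_square[of "Im z"] unfolding power2_eq_square by (simp only: algebra_simps)
  then show ?thesis using pos by simp
qed

lemma hq_cmod_le:
  assumes "z \<in> H2" "w \<in> H2" "hq z w \<le> K"
  shows "cmod (z - w) \<le> (K + 2) * Im z"
proof -
  have pos: "Im z > 0" "Im w > 0" using assms by (auto simp: H2_def)
  have K: "K \<ge> 0" using hq_nonneg[of z w] assms by linarith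
  have "(cmod (z - w))\<^sup>2 \<le> K * (Im z * Im w)"
    using assms pos by (simp add: hq_def field_simps)
  also have "\<dots> \<le> (K + 2) * (Im z * ((K + 2) * Im z))"
    using hq_Im_le[OF assms] pos K by (intro mult_mono) auto
  also have "\<dots> = ((K + 2) * Im z)\<^sup>2" by (simp add: power2_eq_square)
  finally show ?thesis by (rule power2_le_imp_le) (use pos K in simp)
qed

lemma hq_Re_le:
  assumes "z \<in> H2" "w \<in> H2" "hq z w \<le> K"
  shows "\<bar>Re z - Re w\<bar> \<le> (K + 2) * Im z"
  using hq_cmod_le[OF assms] abs_Re_le_cmod[of "z - w"] by simp

text \<open>Converse of the preceding bounds: \<open>hq\<close> is bounded as soon as the heights
  are comparable and the Euclidean distance is bounded in units of height.\<close>

lemma hq_leI: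
  assumes "z \<in> H2" "w \<in> H2" "cmod (z - w) \<le> A * Im z" "Im z \<le> B * Im w"
  shows "hq z w \<le> A\<^sup>2 * B"
proof -
  have pos: "Im z > 0" "Im w > 0" using assms by (auto simp: H2_def)
  have "(cmod (z - w))\<^sup>2 \<le> (A * Im z)\<^sup>2"
    using assms by (intro power_mono) auto
  also have "\<dots> = A\<^sup>2 * Im z * Im z" by (simp add: power2_eq_square)
  also have "\<dots> \<le> A\<^sup>2 * Im z * (B * Im w)"
    using assms pos by (intro mult_left_mono) auto
  finally show ?thesis using pos by (simp add: hq_def field_simps)
qed

text \<open>Replaces the triangle inequality: both hypotheses become Euclidean bounds relative to
  heights, these add up, and \<open>hq_leI\<close> translates back. Any constant depending only on
  \<open>K\<close> and \<open>L\<close> would serve.\<close>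

lemma hq_quasi_triangle:
  assumes "z \<in> H2" "w \<in> H2" "v \<in> H2" "hq z w \<le> K" "hq w v \<le> L"
  shows "hq z v \<le> ((K + 2) * (L + 3))\<^sup>2 * ((K + 2) * (L + 2))"
proof (rule hq_leI[OF assms(1,3)])
  have K: "K \<ge> 0" "L \<ge> 0" using hq_nonneg[of z w] hq_nonneg[of w v] assms by linarith+
  have 1: "Im w \<le> (K + 2) * Im z" by (rule hq_Im_le) (use assms in auto)
  have "cmod (z - v) \<le> cmod (z - w) + cmod (w - v)"
    using norm_triangle_ineq[of "z - w" "w - v"] by simp
  also have "\<dots> \<le> (K + 2) * Im z + (L + 2) * Im w"
    using assms by (intro add_mono hq_cmod_le)
  also have "\<dots> \<le> (K + 2) * Im z + (L + 2) * ((K + 2) * Im z)"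
    using 1 K by (intro add_mono mult_left_mono) auto
  finally show "cmod (z - v) \<le> (K + 2) * (L + 3) * Im z" by (simp add: algebra_simps)
  have "Im z \<le> (K + 2) * Im w" by (rule hq_Im_le) (use assms hq_commute[of z w] in auto)
  also have "\<dots> \<le> (K + 2) * ((L + 2) * Im v)"
    using hq_Im_le[of v w L] assms hq_commute[of v w] K by (intro mult_left_mono) auto
  finally show "Im z \<le> (K + 2) * (L + 2) * Im v" by (simp only: mult.assoc)
qed

section \<open>Maximal separated sets in terms of \<open>hq\<close>: density and bounded
  geometry\<close>

lemma cosh_1_bounds: "5 / 4 \<le> cosh (1::real)" "cosh (1::real) \<le> 2"
proof -
  have e: "5 / 2 \<le> exp (1::real)" "exp (1::real) \<le> 3"
    using exp_lower_Taylor_quadratic[of 1] exp_le by auto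
  have gen: "5 / 4 \<le> (a + b) / 2 \<and> (a + b) / 2 \<le> 2" if "5 / 2 \<le> a" "a \<le> 3" "0 < b" "b \<le> 2 / 5"
    for a b :: real using that by auto
  have "inverse (exp (1::real)) \<le> 2 / 5"
    using le_imp_inverse_le[OF e(1)] by simp
  moreover have "inverse (exp (1::real)) > 0" by simp
  moreover have "cosh (1::real) = (exp 1 + inverse (exp 1)) / 2"
    by (simp add: cosh_field_def exp_minus)
  ultimately show "5 / 4 \<le> cosh (1::real)" "cosh (1::real) \<le> 2"
    using e gen[of "exp 1" "inverse (exp 1)"] by simp_all
qed

text \<open>The value of \<open>hq\<close> at distance \<open>1\<close>. Numerical estimates only
  use that it lies between \<open>1 / 2\<close> and \<open>2\<close>.\<close>

definition \<tau> :: real where "\<tau> = 2 * (cosh 1 - 1)"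

lemma \<tau>_bounds: "1 / 2 \<le> \<tau>" "\<tau> \<le> 2"
  using cosh_1_bounds by (auto simp: \<tau>_def)

lemma separated_hq:
  assumes "maximal_separated_H2 X" "x \<in> X" "y \<in> X" "x \<noteq> y"
  shows "hq x y \<ge> \<tau>"
proof -
  have "x \<in> H2" "y \<in> H2" "hdist x y \<ge> 1"
    using assms by (auto simp: maximal_separated_H2_def separated_def)
  then show ?thesis using hdist_less_iff[of x y 1] by (auto simp: \<tau>_def)
qed

lemma maximal_hq:
  assumes X: "maximal_separated_H2 X" and z: "z \<in> H2"
  shows "\<exists>x\<in>X. hq x z < \<tau>"
proof (cases "z \<in> X")
  case True
  then show ?thesis using \<tau>_bounds by (intro bexI[of _ z]) auto
next
  case False
  then have "\<not> separated hdist 1 (insert z X)" "separated hdist 1 X" "X \<subseteq> H2"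
    using X z by (auto simp: maximal_separated_H2_def)
  then obtain x where "x \<in> X" "hdist x z < 1"
    unfolding separated_def using hdist_commute[of z] by (auto simp: not_le)
  then show ?thesis using hdist_less_iff[of x z 1] z \<open>X \<subseteq> H2\<close> by (auto simp: \<tau>_def)
qed

text \<open>A ball around \<open>z\<close> has Euclidean size of order \<open>Im z\<close>, so
  boundedly many square cells of side \<open>\<epsilon> * Im z\<close> cover it, and two points of
  one cell would be too close. \<open>M\<close> depends on \<open>K\<close> alone.\<close>

lemma card_hq_ball:
  fixes K :: real
  assumes "K \<ge> 0"
  shows "\<exists>M::nat. \<forall>X z. maximal_separated_H2 X \<longrightarrow> z \<in> H2 \<longrightarrow>
    finite {x\<in>X. hq z x \<le> K} \<and> card {x\<in>X. hq z x \<le> K} \<le> M"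
proof -
  \<comment> \<open>Makes \<open>\<epsilon> * (K + 2) = 1 / 4\<close>, so two points of one cell
    have \<open>hq\<close> at most \<open>2 * (1 / 4)^2 = 1 / 8\<close>, below
    \<open>\<tau>\<close>.\<close>
  define \<epsilon> where "\<epsilon> = 1 / (4 * (K + 2))"
  define A where "A = \<lceil>(K + 2) / \<epsilon>\<rceil>"
  define G where "G = {-A..A} \<times> {0..A}"
  have eps: "\<epsilon> > 0" using assms by (simp add: \<epsilon>_def)
  have main: "finite {x\<in>X. hq z x \<le> K} \<and> card {x\<in>X. hq z x \<le> K} \<le> card G"
    if X: "maximal_separated_H2 X" and z: "z \<in> H2" for X z
  proof -
    define S where "S = {x\<in>X. hq z x \<le> K}"
    define f where "f x = (\<lfloor>(Re x - Re z) / (\<epsilon> * Im z)\<rfloor>, \<lfloor>Im x / (\<epsilon> * Im z)\<rfloor>)" for x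
    have XH: "X \<subseteq> H2" using X by (auto simp: maximal_separated_H2_def)
    have zp: "Im z > 0" using z H2_Im_pos by auto
    have "f ` S \<subseteq> G"
    proof (clarsimp simp: G_def f_def)
      fix x assume "x \<in> S"
      then have x: "x \<in> X" "x \<in> H2" "hq z x \<le> K" using XH by (auto simp: S_def)
      have re: "\<bar>Re z - Re x\<bar> \<le> (K + 2) * Im z" using hq_Re_le z x by auto
      have im: "Im x \<le> (K + 2) * Im z" using hq_Im_le z x by auto
      have ip: "Im x > 0" using x H2_Im_pos by auto
      define b where "b = \<epsilon> * Im z"
      have b: "b > 0" using eps zp by (simp add: b_def)
      have e: "(K + 2) / \<epsilon> = ((K + 2) * Im z) / b" using zp by (simp add: b_def)
      have 1: "(Re x - Re z) / b \<le> ((K + 2) * Im z) / b" "Im x / b \<le> ((K + 2) * Im z) / b"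
        "- ((K + 2) * Im z) / b \<le> (Re x - Re z) / b"
        using re im b by (intro divide_right_mono; linarith)+
      have A: "(K + 2) / \<epsilon> \<le> A" unfolding A_def by simp
      have "\<lfloor>(Re x - Re z) / (\<epsilon> * Im z)\<rfloor> \<le> A" "\<lfloor>Im x / (\<epsilon> * Im z)\<rfloor> \<le> A"
           "- A \<le> \<lfloor>(Re x - Re z) / (\<epsilon> * Im z)\<rfloor>"
        using 1 A unfolding e b_def[symmetric] minus_divide_left[symmetric] by linarith+
      moreover have "0 \<le> Im x / (\<epsilon> * Im z)" using ip zp eps by simp
      ultimately show "- A \<le> \<lfloor>(Re x - Re z) / (\<epsilon> * Im z)\<rfloor> \<and>
        \<lfloor>(Re x - Re z) / (\<epsilon> * Im z)\<rfloor> \<le> A \<and> 0 \<le> Im x / (\<epsilon> * Im z) \<and> \<lfloor>Im x / (\<epsilon> * Im z)\<rfloor> \<le> A"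
        by auto
    qed
    moreover have "inj_on f S"
    proof (rule inj_onI, rule ccontr)
      fix x y assume xy: "x \<in> S" "y \<in> S" "f x = f y" "x \<noteq> y"
      then have x: "x \<in> X" "x \<in> H2" "hq z x \<le> K" "y \<in> X" "y \<in> H2" "hq z y \<le> K"
        using XH by (auto simp: S_def)
      have fl: "\<bar>a - b\<bar> \<le> 1" if "\<lfloor>a\<rfloor> = \<lfloor>b\<rfloor>" for a b :: real
        using that by linarith
      have "\<bar>(Re x - Re z) / (\<epsilon> * Im z) - (Re y - Re z) / (\<epsilon> * Im z)\<bar> \<le> 1"
        "\<bar>Im x / (\<epsilon> * Im z) - Im y / (\<epsilon> * Im z)\<bar> \<le> 1"
        using xy(3) by (auto simp: f_def intro!: fl)
      then have "\<bar>Re (x - y)\<bar> / (\<epsilon> * Im z) \<le> 1" "\<bar>Im (x - y)\<bar> / (\<epsilon> * Im z) \<le> 1"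
        using eps zp by (simp_all add: diff_divide_distrib[symmetric])
      then have d: "\<bar>Re (x - y)\<bar> \<le> \<epsilon> * Im z" "\<bar>Im (x - y)\<bar> \<le> \<epsilon> * Im z"
        using eps zp by (simp_all add: divide_le_eq)
      have zx: "Im z \<le> (K + 2) * Im x" "Im z \<le> (K + 2) * Im y"
        using hq_Im_le[of x z K] hq_Im_le[of y z K] x z hq_commute[of x z] hq_commute[of y z] by auto
      have pos: "Im x > 0" "Im y > 0" using x H2_Im_pos by auto
      have "(cmod (x - y))\<^sup>2 = (Re (x - y))\<^sup>2 + (Im (x - y))\<^sup>2" by (rule cmod_power2)
      also have "\<dots> \<le> (\<epsilon> * Im z)\<^sup>2 + (\<epsilon> * Im z)\<^sup>2"
        using d by (intro add_mono) (metis abs_ge_zero power2_abs power_mono)+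
      also have "\<dots> = 2 * (\<epsilon> * Im z) * (\<epsilon> * Im z)" by (simp add: power2_eq_square)
      also have "\<dots> \<le> 2 * (\<epsilon> * ((K + 2) * Im x)) * (\<epsilon> * ((K + 2) * Im y))"
        using zx eps zp pos assms by (intro mult_mono) auto
      also have "\<dots> = 2 * (\<epsilon> * (K + 2))\<^sup>2 * (Im x * Im y)" by (simp add: power2_eq_square)
      also have "\<epsilon> * (K + 2) = 1 / 4" using assms by (simp add: \<epsilon>_def field_simps)
      finally have "hq x y \<le> 1 / 8" using pos by (simp add: hq_def divide_simps power2_eq_square)
      then show False using separated_hq[OF X x(1,4) xy(4)] \<tau>_bounds by auto
    qed
    moreover have "finite G" by (simp add: G_def)
    ultimately have "finite S \<and> card S \<le> card G"
      using card_inj_on_le inj_on_finite by metis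
    then show ?thesis by (simp add: S_def)
  qed
  then show ?thesis by blast
qed

section \<open>Crossings of a rectangle\<close>

definition rect :: "real \<Rightarrow> real \<Rightarrow> real \<Rightarrow> real \<Rightarrow> complex set" where
  "rect a b c d = {z. a \<le> Re z \<and> Re z \<le> b \<and> c \<le> Im z \<and> Im z \<le> d}"

lemma rect_eq_cbox: "rect a b c d = cbox (Complex a c) (Complex b d)"
  by (auto simp: rect_def in_cbox_complex_iff)

text \<open>Brouwer's theorem for the map \<open>z + (u, v)\<close> clamped to the rectangle: at a
  fixed point a nonzero component could only be absorbed by clamping at a side, where its sign is
  wrong for that.\<close>

lemma Poincare_Miranda_rect:
  fixes u v :: "complex \<Rightarrow> real"
  assumes ab: "a \<le> b" and cd: "c \<le> d"
    and u: "continuous_on (rect a b c d) u" and v: "continuous_on (rect a b c d) v"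
    and ua: "\<And>z. z \<in> rect a b c d \<Longrightarrow> Re z = a \<Longrightarrow> u z \<ge> 0"
    and ub: "\<And>z. z \<in> rect a b c d \<Longrightarrow> Re z = b \<Longrightarrow> u z \<le> 0"
    and vc: "\<And>z. z \<in> rect a b c d \<Longrightarrow> Im z = c \<Longrightarrow> v z \<ge> 0"
    and vd: "\<And>z. z \<in> rect a b c d \<Longrightarrow> Im z = d \<Longrightarrow> v z \<le> 0"
  obtains z where "z \<in> rect a b c d" "u z = 0" "v z = 0"
proof -
  let ?B = "rect a b c d"
  define g where "g z = Complex (max a (min b (Re z + u z))) (max c (min d (Im z + v z)))" for z
  have "compact ?B" "convex ?B" by (auto simp: rect_eq_cbox)
  moreover have "Complex a c \<in> ?B" using ab cd by (simp add: rect_def)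
  then have "?B \<noteq> {}" by blast
  moreover have "continuous_on ?B g" unfolding g_def Complex_eq
    by (intro continuous_intros continuous_on_max continuous_on_min u v)
  moreover have "g \<in> ?B \<rightarrow> ?B" using ab cd by (auto simp: g_def rect_def)
  ultimately obtain z where z: "z \<in> ?B" "g z = z" by (rule brouwer)
  have re: "max a (min b (Re z + u z)) = Re z" and im: "max c (min d (Im z + v z)) = Im z"
    using arg_cong[OF z(2), of Re] arg_cong[OF z(2), of Im] by (simp_all add: g_def)
  have "a \<le> Re z" "Re z \<le> b" "c \<le> Im z" "Im z \<le> d" using z by (auto simp: rect_def)
  then have "u z = 0" "v z = 0"
    using re im ua[OF z(1)] ub[OF z(1)] vc[OF z(1)] vd[OF z(1)]
    by (auto simp: max_def min_def split: if_splits)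
  with z show ?thesis using that by blast
qed

definition overlap :: "'b set \<Rightarrow> ('a \<Rightarrow> 'b \<Rightarrow> real) \<Rightarrow> 'a set \<Rightarrow> ('a \<times> 'a) set" where
  "overlap B \<phi> P = {(x, y). x \<in> P \<and> y \<in> P \<and> (\<exists>z\<in>B. \<phi> x z > 0 \<and> \<phi> y z > 0)}"

text \<open>The bumps of a chain component never overlap those of another one, so giving
  opposite signs to the bumps reachable from \<open>S\<close> and to the others creates no cancellation.\<close>

lemma signed_bump_sum:
  fixes \<phi> :: "'a \<Rightarrow> 'b::topological_space \<Rightarrow> real"
  assumes fin: "finite P" and cont: "\<And>x. x \<in> P \<Longrightarrow> continuous_on B (\<phi> x)"
    and nonneg: "\<And>x z. x \<in> P \<Longrightarrow> z \<in> B \<Longrightarrow> \<phi> x z \<ge> 0"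
    and ST: "S \<subseteq> B" "T \<subseteq> B"
    and no: "\<And>x y s t. x \<in> P \<Longrightarrow> y \<in> P \<Longrightarrow> (x, y) \<in> (overlap B \<phi> P)\<^sup>* \<Longrightarrow> s \<in> S \<Longrightarrow> t \<in> T \<Longrightarrow>
      \<phi> x s > 0 \<Longrightarrow> \<phi> y t > 0 \<Longrightarrow> False"
  obtains u :: "'b \<Rightarrow> real" where "continuous_on B u" "\<And>z. z \<in> S \<Longrightarrow> u z \<ge> 0" "\<And>z. z \<in> T \<Longrightarrow> u z \<le> 0"
    "\<And>x z. z \<in> B \<Longrightarrow> u z = 0 \<Longrightarrow> x \<in> P \<Longrightarrow> \<phi> x z = 0"
proof -
  define K where "K = {y\<in>P. \<exists>x\<in>P. \<exists>s\<in>S. \<phi> x s > 0 \<and> (x, y) \<in> (overlap B \<phi> P)\<^sup>*}"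
  define f where "f z = (\<Sum>x\<in>K. \<phi> x z)" for z
  define g where "g z = (\<Sum>x\<in>P-K. \<phi> x z)" for z
  have KP: "K \<subseteq> P" by (auto simp: K_def)
  have finK: "finite K" "finite (P - K)" using fin KP finite_subset by auto
  have c: "continuous_on B (\<lambda>z. f z - g z)"
    unfolding f_def g_def using cont KP by (intro continuous_intros) auto
  have fn: "f z \<ge> 0" and gn: "g z \<ge> 0" if "z \<in> B" for z
    unfolding f_def g_def using nonneg that KP by (auto intro!: sum_nonneg)
  have gS: "g z = 0" if "z \<in> S" for z
  proof -
    have "\<phi> x z = 0" if x: "x \<in> P - K" for x
    proof (rule ccontr)
      assume "\<phi> x z \<noteq> 0"
      then have "\<phi> x z > 0" using nonneg[of x z] \<open>z \<in> S\<close> ST x by force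
      then have "x \<in> K" using x \<open>z \<in> S\<close> unfolding K_def by blast
      then show False using x by simp
    qed
    then show ?thesis by (simp add: g_def)
  qed
  have fT: "f z = 0" if "z \<in> T" for z
  proof -
    have "\<phi> x z = 0" if x: "x \<in> K" for x
    proof (rule ccontr)
      assume "\<phi> x z \<noteq> 0"
      then have "\<phi> x z > 0" using nonneg[of x z] \<open>z \<in> T\<close> ST x KP by force
      then show False using x no \<open>z \<in> T\<close> unfolding K_def by blast
    qed
    then show ?thesis by (simp add: f_def)
  qed
  \<comment> \<open>If a bump is positive where \<open>f\<close> and \<open>g\<close> agree, both
    sums are positive, so a bump of \<open>K\<close> overlaps one outside \<open>K\<close>, although
    \<open>K\<close> is closed under overlap.\<close>
  have zero: "\<phi> x z = 0" if z: "z \<in> B" and u: "f z - g z = 0" and x: "x \<in> P" for x z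
  proof (rule ccontr)
    assume "\<phi> x z \<noteq> 0"
    then have pos: "\<phi> x z > 0" using nonneg[OF x z] by simp
    have "\<exists>k\<in>K. \<phi> k z > 0"
    proof (rule ccontr)
      assume n: "\<not> (\<exists>k\<in>K. \<phi> k z > 0)"
      then have "f z \<le> 0" by (auto simp: f_def not_less intro!: sum_nonpos)
      moreover have "x \<in> P - K" using n pos x by auto
      then have "\<phi> x z \<le> g z" unfolding g_def using finK nonneg z by (intro member_le_sum) auto
      ultimately show False using u pos by simp
    qed
    moreover have "\<exists>k\<in>P-K. \<phi> k z > 0"
    proof (rule ccontr)
      assume n: "\<not> (\<exists>k\<in>P-K. \<phi> k z > 0)"
      then have "g z \<le> 0" by (auto simp: g_def not_less intro!: sum_nonpos)
      moreover have "x \<in> K" using n pos x by auto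
      then have "\<phi> x z \<le> f z" unfolding f_def using finK nonneg z KP by (intro member_le_sum) auto
      ultimately show False using u pos by simp
    qed
    ultimately obtain k l where kl: "k \<in> K" "l \<in> P - K" "\<phi> k z > 0" "\<phi> l z > 0" by blast
    then have "(k, l) \<in> overlap B \<phi> P" using KP z by (auto simp: overlap_def)
    then have "l \<in> K" using kl unfolding K_def by (auto intro: rtrancl_into_rtrancl)
    then show False using kl by simp
  qed
  show ?thesis
  proof (rule that[OF c])
    show "f z - g z \<ge> 0" if "z \<in> S" for z using fn[of z] gS[of z] ST that by auto
    show "f z - g z \<le> 0" if "z \<in> T" for z using gn[of z] fT[of z] ST that by auto
  qed (use zero in blast)
qed

text \<open>If both crossings fail, \<open>signed_bump_sum\<close> yields \<open>u\<close> from
  \<open>P\<close> and \<open>v\<close> from \<open>Q\<close> with the boundary signs of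
  \<open>Poincare_Miranda_rect\<close>. At a common zero every bump vanishes, against
  \<open>cover\<close>.\<close>

lemma hex_crossing:
  fixes \<phi> :: "'a \<Rightarrow> complex \<Rightarrow> real"
  assumes ab: "a \<le> b" and cd: "c \<le> d" and fin: "finite P" "finite Q"
    and cont: "\<And>x. x \<in> P \<union> Q \<Longrightarrow> continuous_on (rect a b c d) (\<phi> x)"
    and nonneg: "\<And>x z. x \<in> P \<union> Q \<Longrightarrow> z \<in> rect a b c d \<Longrightarrow> \<phi> x z \<ge> 0"
    and cover: "\<And>z. z \<in> rect a b c d \<Longrightarrow> \<exists>x\<in>P\<union>Q. \<phi> x z > 0"
  shows "(\<exists>x\<in>P. \<exists>y\<in>P. \<exists>s\<in>rect a b c d. \<exists>t\<in>rect a b c d. Re s = a \<and> Re t = b \<and>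
            \<phi> x s > 0 \<and> \<phi> y t > 0 \<and> (x, y) \<in> (overlap (rect a b c d) \<phi> P)\<^sup>*) \<or>
         (\<exists>x\<in>Q. \<exists>y\<in>Q. \<exists>s\<in>rect a b c d. \<exists>t\<in>rect a b c d. Im s = c \<and> Im t = d \<and>
            \<phi> x s > 0 \<and> \<phi> y t > 0 \<and> (x, y) \<in> (overlap (rect a b c d) \<phi> Q)\<^sup>*)"
proof (rule ccontr)
  let ?B = "rect a b c d"
  assume "\<not> ?thesis"
  note neg = this[unfolded de_Morgan_disj, THEN conjunct1] this[unfolded de_Morgan_disj, THEN conjunct2]
  have noP: False if "x \<in> P" "y \<in> P" "(x, y) \<in> (overlap ?B \<phi> P)\<^sup>*"
      "s \<in> {z\<in>?B. Re z = a}" "t \<in> {z\<in>?B. Re z = b}" "\<phi> x s > 0" "\<phi> y t > 0" for x y s t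
    using neg(1) that by blast
  have cnP: "continuous_on ?B (\<phi> x)" "z \<in> ?B \<Longrightarrow> \<phi> x z \<ge> 0" if "x \<in> P" for x z
    using cont nonneg that by auto
  obtain u :: "complex \<Rightarrow> real" where u: "continuous_on ?B u" "\<And>z. z \<in> {z\<in>?B. Re z = a} \<Longrightarrow> u z \<ge> 0"
    "\<And>z. z \<in> {z\<in>?B. Re z = b} \<Longrightarrow> u z \<le> 0" "\<And>x z. z \<in> ?B \<Longrightarrow> u z = 0 \<Longrightarrow> x \<in> P \<Longrightarrow> \<phi> x z = 0"
    by (rule signed_bump_sum[OF fin(1) cnP, where S = "{z\<in>?B. Re z = a}" and T = "{z\<in>?B. Re z = b}"]; (erule (6) noP)?) auto
  have noQ: False if "x \<in> Q" "y \<in> Q" "(x, y) \<in> (overlap ?B \<phi> Q)\<^sup>*"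
      "s \<in> {z\<in>?B. Im z = c}" "t \<in> {z\<in>?B. Im z = d}" "\<phi> x s > 0" "\<phi> y t > 0" for x y s t
    using neg(2) that by blast
  have cnQ: "continuous_on ?B (\<phi> x)" "z \<in> ?B \<Longrightarrow> \<phi> x z \<ge> 0" if "x \<in> Q" for x z
    using cont nonneg that by auto
  obtain v :: "complex \<Rightarrow> real" where v: "continuous_on ?B v" "\<And>z. z \<in> {z\<in>?B. Im z = c} \<Longrightarrow> v z \<ge> 0"
    "\<And>z. z \<in> {z\<in>?B. Im z = d} \<Longrightarrow> v z \<le> 0" "\<And>x z. z \<in> ?B \<Longrightarrow> v z = 0 \<Longrightarrow> x \<in> Q \<Longrightarrow> \<phi> x z = 0"
    by (rule signed_bump_sum[OF fin(2) cnQ, where S = "{z\<in>?B. Im z = c}" and T = "{z\<in>?B. Im z = d}"]; (erule (6) noQ)?) auto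
  obtain z where "z \<in> ?B" "u z = 0" "v z = 0"
    by (rule Poincare_Miranda_rect[OF ab cd u(1) v(1)]) (use u v in auto)
  with u(4) v(4) cover show False by fastforce
qed

text \<open>Subadditivity of Lebesgue measure for the intervals of radius \<open>r z\<close> about
  \<open>p z\<close>.\<close>

lemma length_le_sum_of_cover:
  fixes p r :: "'a \<Rightarrow> real"
  assumes fin: "finite Z" and r: "\<And>z. z \<in> Z \<Longrightarrow> r z \<ge> 0"
    and cov: "\<And>t. a \<le> t \<Longrightarrow> t \<le> b \<Longrightarrow> \<exists>z\<in>Z. \<bar>p z - t\<bar> \<le> r z"
  shows "b - a \<le> (\<Sum>z\<in>Z. 2 * r z)"
proof (cases "a \<le> b")
  case True
  have "{a..b} \<subseteq> (\<Union>z\<in>Z. {p z - r z..p z + r z})" using cov by (force simp: abs_le_iff)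
  then have "measure lborel {a..b} \<le> measure lborel (\<Union>z\<in>Z. {p z - r z..p z + r z})"
    using fin by (intro measure_mono_fmeasurable fmeasurable.finite_UN) (auto simp: fmeasurable_def emeasure_lborel_Icc_eq)
  also have "\<dots> \<le> (\<Sum>z\<in>Z. measure lborel {p z - r z..p z + r z})"
    using fin by (intro measure_UNION_le) auto
  also have "\<dots> = (\<Sum>z\<in>Z. 2 * r z)" by (intro sum.cong) (use r in auto)
  finally show ?thesis using True by simp
next
  case False
  then show ?thesis using r sum_nonneg[of Z "\<lambda>z. 2 * r z"] by force
qed

text \<open>Cuts the path at its first exit from \<open>P\<close>. The induction carries the
  alternative that the path has stayed inside so far or an exit has been found.\<close>

lemma rtrancl_exit:
  assumes "(q, p) \<in> E\<^sup>*" "P q" "\<not> P p"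
  obtains z w where "(q, z) \<in> (E \<inter> {(x, y). P x \<and> P y})\<^sup>*" "P z" "(z, w) \<in> E" "\<not> P w"
proof -
  define R where "R = E \<inter> {(x, y). P x \<and> P y}"
  have "((q, p) \<in> R\<^sup>* \<and> P p) \<or> (\<exists>z w. (q, z) \<in> R\<^sup>* \<and> P z \<and> (z, w) \<in> E \<and> \<not> P w)"
    using assms(1)
  proof induction
    case base
    then show ?case using assms(2) by simp
  next
    case (step y z)
    show ?case
    proof (cases "(q, y) \<in> R\<^sup>* \<and> P y \<and> P z")
      case True
      then have "(y, z) \<in> R" using step(2) by (simp add: R_def)
      then show ?thesis using True by (meson rtrancl.rtrancl_into_rtrancl)
    next
      case False
      then show ?thesis using step by blast
    qed
  qed
  then show ?thesis using assms(3) that by (auto simp: R_def)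
qed

section \<open>Chains in sets of polynomial growth\<close>

text \<open>The reflexive transitive closure of this relation is the discrete substitute for
  connectedness.\<close>

definition chain :: "real \<Rightarrow> complex set \<Rightarrow> (complex \<times> complex) set" where
  "chain \<kappa> Z = {(x, y). x \<in> Z \<and> y \<in> Z \<and> hq x y \<le> \<kappa>}"

lemma chain_sym: "sym (chain \<kappa> Z)"
  by (auto simp: chain_def sym_def hq_commute)

lemma chain_rtrancl_in: "(x, y) \<in> (chain \<kappa> Z)\<^sup>* \<Longrightarrow> x \<in> Z \<Longrightarrow> y \<in> Z"
  by (induction rule: rtrancl_induct) (auto simp: chain_def)

text \<open>A discrete intermediate value theorem: the step that jumps over \<open>t\<close> starts
  at some \<open>z\<close> and moves the real part by at most
  \<open>(\<kappa> + 2) * Im z\<close>.\<close>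

lemma chain_covers:
  assumes ch: "(x, y) \<in> (chain \<kappa> Z)\<^sup>*" and x: "x \<in> Z" and Z: "Z \<subseteq> H2" and k: "\<kappa> \<ge> 0"
    and t: "min (Re x) (Re y) \<le> t" "t \<le> max (Re x) (Re y)"
  obtains z where "(x, z) \<in> (chain \<kappa> Z)\<^sup>*" "\<bar>Re z - t\<bar> \<le> (\<kappa> + 2) * Im z"
proof -
  have "\<exists>z. (x, z) \<in> (chain \<kappa> Z)\<^sup>* \<and> \<bar>Re z - t\<bar> \<le> (\<kappa> + 2) * Im z"
    using ch t
  proof (induction)
    case base
    then have "t = Re x" by simp
    moreover have "Im x > 0" using x Z H2_Im_pos by auto
    ultimately show ?case using k by (intro exI[of _ x]) auto
  next
    case (step y w)
    show ?case
    proof (cases "min (Re x) (Re y) \<le> t \<and> t \<le> max (Re x) (Re y)")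
      case True
      then show ?thesis using step by blast
    next
      case False
      have yw: "y \<in> Z" "w \<in> Z" "hq y w \<le> \<kappa>" using step(2) by (auto simp: chain_def)
      then have "\<bar>Re y - Re w\<bar> \<le> (\<kappa> + 2) * Im y" using Z by (intro hq_Re_le) auto
      moreover have "\<bar>Re y - t\<bar> \<le> \<bar>Re y - Re w\<bar>" using False step(4,5) by linarith
      ultimately show ?thesis using step(1) by fastforce
    qed
  qed
  then show ?thesis using that by blast
qed

text \<open>Layer \<open>j\<close> contributes at most \<open>B * 2 ^ j * (Y / 16 ^ j)\<close>, that
  is \<open>B * Y / 8 ^ j\<close>, and the geometric series sums to less than
  \<open>2 * B * Y\<close>.\<close>

lemma sum_layers_le:
  fixes f :: "'a \<Rightarrow> real"
  assumes fin: "finite Z" and f: "\<And>z. z \<in> Z \<Longrightarrow> 0 < f z \<and> f z \<le> Y" and B: "B \<ge> 0" and Y: "Y > 0"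
    and card: "\<And>j. real (card {z\<in>Z. Y \<le> 16 ^ (j + 1) * f z \<and> 16 ^ j * f z \<le> Y}) \<le> B * 2 ^ j"
  shows "(\<Sum>z\<in>Z. f z) \<le> 2 * B * Y"
proof -
  \<comment> \<open>The least index with the lower bound also has the upper bound: by minimality if
    it is positive, by \<open>f z \<le> Y\<close> if it is \<open>0\<close>.\<close>
  define lev where "lev z = (LEAST j. Y \<le> 16 ^ (j + 1) * f z)" for z
  have lev: "Y \<le> 16 ^ (lev z + 1) * f z" "16 ^ lev z * f z \<le> Y" if z: "z \<in> Z" for z
  proof -
    obtain n where "Y / f z < 16 ^ n" using real_arch_pow[of 16 "Y / f z"] by auto
    then have "Y \<le> 16 ^ n * f z" using f[OF z] by (simp add: field_simps)
    also have "\<dots> \<le> 16 ^ (n + 1) * f z" using f[OF z] by simp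
    finally show 1: "Y \<le> 16 ^ (lev z + 1) * f z" unfolding lev_def by (rule LeastI)
    show "16 ^ lev z * f z \<le> Y"
    proof (cases "lev z")
      case 0
      then show ?thesis using f[OF z] by simp
    next
      case (Suc k)
      then have "\<not> Y \<le> 16 ^ (k + 1) * f z" using not_less_Least[of k "\<lambda>j. Y \<le> 16 ^ (j + 1) * f z"]
        by (simp add: lev_def)
      then show ?thesis using Suc by simp
    qed
  qed
  define J where "J = Suc (Max (insert 0 (lev ` Z)))"
  have J: "lev ` Z \<subseteq> {..<J}" using fin by (auto simp: J_def less_Suc_eq_le)
  have layer: "(\<Sum>z\<in>{z\<in>Z. lev z = j}. f z) \<le> B * Y * (1 / 8) ^ j" for j
  proof -
    have "(\<Sum>z\<in>{z\<in>Z. lev z = j}. f z) \<le> (\<Sum>z\<in>{z\<in>Z. lev z = j}. Y / 16 ^ j)"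
      using lev(2) by (intro sum_mono) (auto simp: field_simps)
    also have "\<dots> = real (card {z\<in>Z. lev z = j}) * (Y / 16 ^ j)" by simp
    also have "\<dots> \<le> (B * 2 ^ j) * (Y / 16 ^ j)"
    proof (rule mult_right_mono)
      have "card {z\<in>Z. lev z = j} \<le> card {z\<in>Z. Y \<le> 16 ^ (j + 1) * f z \<and> 16 ^ j * f z \<le> Y}"
        using fin lev by (intro card_mono) auto
      then show "real (card {z\<in>Z. lev z = j}) \<le> B * 2 ^ j" using card[of j] by linarith
    qed (use Y in simp)
    also have "(16::real) ^ j = 2 ^ j * 8 ^ j" by (simp flip: power_mult_distrib)
    finally show ?thesis by (simp add: power_divide)
  qed
  have "(\<Sum>z\<in>Z. f z) = (\<Sum>j<J. \<Sum>z\<in>{z\<in>Z. lev z = j}. f z)"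
    using sum.group[OF fin _ J, of f] by simp
  also have "\<dots> \<le> (\<Sum>j<J. B * Y * (1 / 8) ^ j)" by (intro sum_mono layer)
  also have "\<dots> = B * Y * (\<Sum>j<J. (1 / 8) ^ j)" by (simp add: sum_distrib_left)
  also have "\<dots> \<le> B * Y * 2"
  proof (rule mult_left_mono)
    show "(\<Sum>j<J. (1 / 8 :: real) ^ j) \<le> 2" unfolding sum_gp_strict by (simp add: field_simps)
  qed (use B Y in simp)
  finally show ?thesis by (simp add: mult_ac)
qed

text \<open>The fourth power makes the growth on the layers \<open>16 ^ j\<close> of \<open>sum_layers_le\<close> proportional to \<open>2 ^ j\<close>.\<close>

definition growth4 :: "real \<Rightarrow> complex set \<Rightarrow> bool" where
  "growth4 A W \<longleftrightarrow> W \<subseteq> H2 \<and> (\<forall>x\<in>W. \<forall>T\<ge>0. finite {z\<in>W. hq x z \<le> T} \<and>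
     real (card {z\<in>W. hq x z \<le> T}) ^ 4 \<le> A * (2 + T))"

text \<open>Seen from a highest point \<open>p\<close> of the chain, a chain running horizontally over a width
  \<open>N * Im p\<close> needs, on some level \<open>Im p / 16 ^ j\<close>, of the order of \<open>16 ^ j\<close> points at
  \<open>cosh\<close>-distance \<open>N\<^sup>2 * 16 ^ j\<close>, which is more than the growth allows when \<open>N\<close> is large.\<close>

lemma horizontal_extent_of_chain:
  fixes A \<kappa> :: real
  assumes A: "A \<ge> 0" and k: "\<kappa> \<ge> 0"
  obtains N where "N \<ge> 1" "\<And>W Z x y H. growth4 A W \<Longrightarrow> Z \<subseteq> W \<Longrightarrow> finite Z \<Longrightarrow> x \<in> Z \<Longrightarrow>
    (x, y) \<in> (chain \<kappa> Z)\<^sup>* \<Longrightarrow> \<forall>z\<in>Z. Im z \<le> H \<Longrightarrow> \<bar>Re x - Re y\<bar> \<le> N * H"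
proof -
  define c where "c = \<kappa> + 2"
  \<comment> \<open>The argument ends with
    \<open>N ^ 4 \<le> (8 * c * B) ^ 4 = E * D^2 \<le> E * N^2\<close>, where
    \<open>73728 = 8 ^ 4 * 18\<close>. Taking \<open>N > E\<close> with \<open>N \<ge> 1\<close>
    refutes it, and \<open>c + 1 \<le> N / 2\<close> ensures \<open>D \<le> N\<close>.\<close>
  define E where "E = 73728 * c ^ 4 * A"
  define N where "N = 2 * (c + 1) + E + 1"
  have c: "c \<ge> 2" using k by (simp add: c_def)
  have E: "E \<ge> 0" using A by (simp add: E_def)
  have N: "N \<ge> 1" "N > E" "c + 1 \<le> N / 2" using c E by (auto simp: N_def)
  have main: "\<bar>Re x - Re y\<bar> \<le> N * H"
    if W: "growth4 A W" and Z: "Z \<subseteq> W" "finite Z" and x: "x \<in> Z"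
    and ch: "(x, y) \<in> (chain \<kappa> Z)\<^sup>*" and H: "\<forall>z\<in>Z. Im z \<le> H" for W Z x y H
  proof (rule ccontr)
    assume far: "\<not> \<bar>Re x - Re y\<bar> \<le> N * H"
    have WH: "W \<subseteq> H2" using W by (simp add: growth4_def)
    then have ZH: "Z \<subseteq> H2" using Z by auto
    define R where "R = {z. (x, z) \<in> (chain \<kappa> Z)\<^sup>*}"
    have RZ: "R \<subseteq> Z" using chain_rtrancl_in x by (auto simp: R_def)
    have finR: "finite R" using RZ Z finite_subset by blast
    have xyR: "x \<in> R" "y \<in> R" using ch by (auto simp: R_def)
    obtain p where p: "p \<in> R" "\<And>z. z \<in> R \<Longrightarrow> Im z \<le> Im p"
      using finR xyR Max_in[of "Im ` R"] Max_ge[of "Im ` R"] by fastforce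
    define h where "h = Im p"
    have h: "h > 0" "h \<le> H" using p RZ ZH H H2_Im_pos by (auto simp: h_def)
    have R_conn: "(p, z) \<in> (chain \<kappa> Z)\<^sup>*" if "z \<in> R" for z
    proof -
      have "(p, x) \<in> (chain \<kappa> Z)\<^sup>*"
        using p(1) sym_rtrancl[OF chain_sym[of \<kappa> Z]] by (auto simp: R_def dest: symD)
      then show ?thesis using that by (auto simp: R_def)
    qed
    have "\<exists>q\<in>R. \<bar>Re q - Re p\<bar> > N * h / 2"
    proof (rule ccontr)
      assume "\<not> ?thesis"
      then have "\<bar>Re x - Re p\<bar> \<le> N * h / 2" "\<bar>Re y - Re p\<bar> \<le> N * h / 2" using xyR by auto
      then have "\<bar>Re x - Re y\<bar> \<le> N * h" by linarith
      also have "\<dots> \<le> N * H" using h N by simp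
      finally show False using far by simp
    qed
    then obtain q where q: "q \<in> R" "\<bar>Re q - Re p\<bar> > N * h / 2" by blast
    \<comment> \<open>The interval from \<open>s\<close> of length \<open>N * h / 2\<close> has
      \<open>Re p\<close> as one end and lies between \<open>Re p\<close> and \<open>Re q\<close>,
      so the chain covers it.\<close>
    define s where "s = (if Re q \<ge> Re p then Re p else Re p - N * h / 2)"
    define R' where "R' = {z\<in>R. \<bar>Re z - Re p\<bar> \<le> (N / 2 + c) * h}"
    have cov: "\<exists>z\<in>R'. \<bar>Re z - t\<bar> \<le> c * Im z" if t: "s \<le> t" "t \<le> s + N * h / 2" for t
    proof -
      have tp: "\<bar>t - Re p\<bar> \<le> N * h / 2" "min (Re p) (Re q) \<le> t" "t \<le> max (Re p) (Re q)"
        using t q h N by (auto simp: s_def split: if_splits)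
      obtain z where z: "(p, z) \<in> (chain \<kappa> Z)\<^sup>*" "\<bar>Re z - t\<bar> \<le> (\<kappa> + 2) * Im z"
        by (rule chain_covers[OF R_conn[OF q(1)] _ ZH k tp(2,3)]) (use p RZ in auto)
      have zR: "z \<in> R" using z(1) p(1) by (auto simp: R_def)
      have "\<bar>Re z - t\<bar> \<le> c * Im z" using z by (simp add: c_def)
      moreover have "c * Im z \<le> c * h" using p(2)[OF zR] c by (simp add: h_def)
      ultimately have "\<bar>Re z - Re p\<bar> \<le> N * h / 2 + c * h" using tp by linarith
      then have "z \<in> R'" using zR by (simp add: R'_def algebra_simps)
      then show ?thesis using \<open>\<bar>Re z - t\<bar> \<le> c * Im z\<close> by blast
    qed
    have finR': "finite R'" using finR by (simp add: R'_def)
    have R'_Im: "0 < Im z \<and> Im z \<le> h" if "z \<in> R'" for z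
      using that p RZ ZH H2_Im_pos by (auto simp: R'_def h_def)
    have "N * h / 2 \<le> (\<Sum>z\<in>R'. 2 * (c * Im z))"
      using length_le_sum_of_cover[OF finR', of "\<lambda>z. c * Im z" s "s + N * h / 2" Re] cov R'_Im c
      by (auto simp: less_imp_le)
    also have "\<dots> = 2 * c * (\<Sum>z\<in>R'. Im z)" by (simp add: sum_distrib_left mult.assoc)
    finally have 1: "N * h / 2 \<le> 2 * c * (\<Sum>z\<in>R'. Im z)" .
    define D where "D = N / 2 + c + 1"
    \<comment> \<open>Turns the growth bound \<open>18 * A * D^2 * 16 ^ j\<close> for the fourth
      power of the layer's cardinality into \<open>(B * 2 ^ j) ^ 4\<close>.\<close>
    define B where "B = root 4 (18 * A * D\<^sup>2)"
    have D: "D \<ge> 1" "D \<le> N" using N c by (auto simp: D_def)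
    have B: "B \<ge> 0" "B ^ 4 = 18 * A * D\<^sup>2" using A by (auto simp: B_def)
    have "(\<Sum>z\<in>R'. Im z) \<le> 2 * B * h"
    proof (rule sum_layers_le[OF finR' R'_Im B(1) h(1)])
      fix j :: nat
      define L where "L = {z\<in>R'. h \<le> 16 ^ (j + 1) * Im z \<and> 16 ^ j * Im z \<le> h}"
      define T where "T = D\<^sup>2 * 16 ^ (j + 1)"
      have pW: "p \<in> W" "p \<in> H2" using p RZ Z WH by auto
      have "L \<subseteq> {z\<in>W. hq p z \<le> T}"
      proof
        fix z assume z: "z \<in> L"
        then have zz: "z \<in> W" "z \<in> H2" "z \<in> R'" using RZ Z ZH by (auto simp: L_def R'_def)
        have "cmod (p - z) \<le> \<bar>Re (p - z)\<bar> + \<bar>Im (p - z)\<bar>" by (rule cmod_le)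
        also have "\<dots> \<le> (N / 2 + c) * h + h"
          using zz(3) R'_Im[OF zz(3)] by (intro add_mono) (auto simp: R'_def h_def)
        also have "\<dots> = D * h" by (simp add: D_def algebra_simps)
        finally have "cmod (p - z) \<le> D * h" .
        then have "hq p z \<le> T" unfolding T_def
          using z by (intro hq_leI[OF pW(2) zz(2)]) (auto simp: L_def h_def)
        then show "z \<in> {z\<in>W. hq p z \<le> T}" using zz by simp
      qed
      moreover have T: "T \<ge> 0" by (simp add: T_def)
      then have fT: "finite {z\<in>W. hq p z \<le> T}" "real (card {z\<in>W. hq p z \<le> T}) ^ 4 \<le> A * (2 + T)"
        using W pW by (auto simp: growth4_def)
      ultimately have "real (card L) \<le> real (card {z\<in>W. hq p z \<le> T})"
        by (simp add: card_mono)
      then have "real (card L) ^ 4 \<le> A * (2 + T)" using fT(2) power_mono by (meson of_nat_0_le_iff order_trans)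
      also have "A * (2 + T) \<le> A * (18 * D\<^sup>2 * 16 ^ j)"
      proof (rule mult_left_mono[OF _ A])
        have "1 * 1 \<le> D\<^sup>2 * 16 ^ j" using D by (intro mult_mono) auto
        then show "2 + T \<le> 18 * D\<^sup>2 * 16 ^ j" by (simp add: T_def)
      qed
      also have "\<dots> = (B * 2 ^ j) ^ 4"
        using B(2) by (simp add: power_mult_distrib power_mult[symmetric] mult.commute[of j] power_mult)
      finally show "real (card {z\<in>R'. h \<le> 16 ^ (j + 1) * Im z \<and> 16 ^ j * Im z \<le> h}) \<le> B * 2 ^ j"
        using B(1) unfolding L_def[symmetric] by (simp add: power_mono_iff)
    qed
    then have "N * h / 2 \<le> 2 * c * (2 * B * h)" using 1 c by (meson mult_left_mono order_trans zero_le_mult_iff zero_le_numeral dual_order.trans)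
    then have "N \<le> 8 * c * B" using h by (simp add: field_simps)
    then have "N ^ 4 \<le> (8 * c * B) ^ 4" using N by (intro power_mono) auto
    also have "\<dots> = E * D\<^sup>2" using B(2) by (simp add: power_mult_distrib E_def)
    also have "\<dots> \<le> E * N\<^sup>2" using D E by (intro mult_left_mono power_mono) auto
    finally have "N\<^sup>2 * N\<^sup>2 \<le> E * N\<^sup>2" by (simp add: power2_eq_square power4_eq_xxxx mult.assoc)
    then have "N\<^sup>2 \<le> E" by (rule mult_right_le_imp_le) (use N in simp)
    moreover have "N * 1 \<le> N * N" using N by (intro mult_left_mono) auto
    ultimately show False using N by (simp add: power2_eq_square)
  qed
  show ?thesis by (rule that[OF N(1)]) (use main in blast)
qed

section \<open>Polynomial growth in the distance implies \<open>growth4\<close>\<close>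

lemma arcosh_le_ln:
  fixes x :: real assumes "x \<ge> 1" shows "arcosh x \<le> ln (2 * x)"
proof -
  have "sqrt (x\<^sup>2 - 1) \<le> x" using assms by (intro real_le_lsqrt) auto
  moreover have "sqrt (x\<^sup>2 - 1) \<ge> 0" using assms by (simp add: one_le_power)
  ultimately have "ln (x + sqrt (x\<^sup>2 - 1)) \<le> ln (2 * x)" using assms by (subst ln_le_cancel_iff) linarith+
  then show ?thesis using assms by (simp add: arcosh_real_def)
qed

lemma one_plus_power_le_exp:
  fixes L :: real assumes "L \<ge> 0" shows "(1 + L) ^ n \<le> real n ^ n * exp L"
proof (cases "n = 0")
  case False
  have "(1 + L) ^ n \<le> (real n * (1 + L / real n)) ^ n"
    using assms False by (intro power_mono) (auto simp: field_simps)
  also have "\<dots> = real n ^ n * (1 + L / real n) ^ n" by (simp add: power_mult_distrib)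
  also have "\<dots> \<le> real n ^ n * exp L"
    using assms by (intro mult_left_mono exp_ge_one_plus_x_over_n_power_n) (use False in auto)
  finally show ?thesis .
qed (use assms in simp)

text \<open>The ball \<open>hq x z \<le> T\<close> has hyperbolic radius at most
  \<open>L = ln (2 + T)\<close>. The fourth power of a polynomial in \<open>L\<close> is still
  bounded by a multiple of \<open>exp L = 2 + T\<close>, and \<open>A\<close> depends only on
  \<open>C\<close> and \<open>d\<close>.\<close>

lemma poly_growth_imp_growth4:
  fixes C :: real and d :: nat
  obtains A where "A \<ge> 0" "\<And>W. W \<subseteq> H2 \<Longrightarrow> \<forall>x\<in>W. \<forall>\<rho>\<ge>0. finite {z\<in>W. hdist x z \<le> \<rho>} \<and>
    real (card {z\<in>W. hdist x z \<le> \<rho>}) \<le> C * \<rho> ^ d + C \<Longrightarrow> growth4 A W"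
proof -
  define A where "A = 16 * \<bar>C\<bar> ^ 4 * real (4 * d) ^ (4 * d)"
  have main: "growth4 A W" if W: "W \<subseteq> H2" and gr: "\<forall>x\<in>W. \<forall>\<rho>\<ge>0. finite {z\<in>W. hdist x z \<le> \<rho>} \<and>
    real (card {z\<in>W. hdist x z \<le> \<rho>}) \<le> C * \<rho> ^ d + C" for W
    unfolding growth4_def
  proof (intro conjI ballI allI impI)
    fix x and T :: real assume x: "x \<in> W" and T: "T \<ge> 0"
    define L where "L = ln (2 + T)"
    have L: "L \<ge> 0" "exp L = 2 + T" using T by (auto simp: L_def)
    have sub: "{z\<in>W. hq x z \<le> T} \<subseteq> {z\<in>W. hdist x z \<le> L}"
    proof safe
      fix z assume z: "z \<in> W" "hq x z \<le> T"
      have "hdist x z \<le> arcosh (1 + T / 2)" using hdist_le_arcosh z x W by auto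
      also have "\<dots> \<le> L" using arcosh_le_ln[of "1 + T / 2"] T by (simp add: L_def algebra_simps)
      finally show "hdist x z \<le> L" .
    qed
    have g: "finite {z\<in>W. hdist x z \<le> L}" "real (card {z\<in>W. hdist x z \<le> L}) \<le> C * L ^ d + C"
      using gr x L(1) by auto
    show "finite {z\<in>W. hq x z \<le> T}" using sub g(1) finite_subset by blast
    have p1: "L ^ d \<le> (1 + L) ^ d" "1 \<le> (1 + L) ^ d" using L by (auto intro!: power_mono one_le_power)
    have "real (card {z\<in>W. hq x z \<le> T}) \<le> C * (L ^ d + 1)"
      using card_mono[OF g(1) sub] g(2) by (simp add: algebra_simps)
    also have "\<dots> \<le> \<bar>C\<bar> * (2 * (1 + L) ^ d)"
    proof (rule mult_mono)
      show "L ^ d + 1 \<le> 2 * (1 + L) ^ d" using p1 by linarith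
    qed (use L in auto)
    finally have "real (card {z\<in>W. hq x z \<le> T}) ^ 4 \<le> (\<bar>C\<bar> * (2 * (1 + L) ^ d)) ^ 4"
      by (intro power_mono) auto
    also have "\<dots> = 16 * \<bar>C\<bar> ^ 4 * (1 + L) ^ (4 * d)"
      by (simp add: power_mult_distrib power_mult[symmetric] mult.commute)
    also have "\<dots> \<le> 16 * \<bar>C\<bar> ^ 4 * (real (4 * d) ^ (4 * d) * exp L)"
      using one_plus_power_le_exp[OF L(1), of "4 * d"] by (intro mult_left_mono) auto
    finally show "real (card {z\<in>W. hq x z \<le> T}) ^ 4 \<le> A * (2 + T)"
      by (simp add: A_def L(2) mult.assoc)
  qed (use W in blast)
  show ?thesis by (rule that[of A]) (use main in \<open>auto simp: A_def\<close>)
qed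

section \<open>Lower bound\<close>

lemma iter_nbhd_subset:
  assumes "\<And>Y. Y \<in> \<Y> \<Longrightarrow> Y \<subseteq> X" "W \<in> \<Y>"
  shows "iter_nbhd \<delta> X \<Y> s n W \<subseteq> X"
  using assms by (cases n) auto

lemma iter_nbhd_self:
  assumes "\<And>Y. Y \<in> \<Y> \<Longrightarrow> Y \<subseteq> X" "W \<in> \<Y>" "\<And>x. \<delta> x x \<le> s"
  shows "W \<subseteq> iter_nbhd \<delta> X \<Y> s n W"
proof (induction n)
  case (Suc n)
  show ?case
  proof
    fix x assume x: "x \<in> W"
    then have "x \<in> W \<inter> nbhd \<delta> X s (iter_nbhd \<delta> X \<Y> s n W)"
      using Suc assms(1)[OF assms(2)] assms(3) unfolding nbhd_def by blast
    then show "x \<in> iter_nbhd \<delta> X \<Y> s (Suc n) W" using x assms(2) by auto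
  qed
qed simp

text \<open>Lets the count of points pass from a leg to the legs it touches, at the cost of one
  iteration.\<close>

lemma iter_nbhd_Suc_mono:
  assumes "W' \<in> \<Y>" "W' \<inter> nbhd \<delta> X s W \<noteq> {}"
  shows "iter_nbhd \<delta> X \<Y> s n W' \<subseteq> iter_nbhd \<delta> X \<Y> s (Suc n) W"
proof (induction n)
  case 0
  then show ?case using assms by auto
next
  case (Suc n)
  then have "nbhd \<delta> X s (iter_nbhd \<delta> X \<Y> s n W') \<subseteq> nbhd \<delta> X s (iter_nbhd \<delta> X \<Y> s (Suc n) W)"
    unfolding nbhd_def by blast
  then show ?case unfolding iter_nbhd.simps(2)[of _ _ _ _ "Suc n"] iter_nbhd.simps(2)[of _ _ _ _ n W'] by blast
qed

lemma finite_window: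
  assumes X: "maximal_separated_H2 X"
  shows "finite {z\<in>X. 1 / 4 \<le> Im z \<and> Im z \<le> 4 \<and> a \<le> Re z \<and> Re z \<le> b}"
proof -
  define z0 where "z0 = Complex a 1"
  define K where "K = (\<bar>b - a\<bar> + 4)\<^sup>2 * 4"
  have z0: "z0 \<in> H2" by (simp add: z0_def H2_def)
  have XH: "X \<subseteq> H2" using X by (simp add: maximal_separated_H2_def)
  have "{z\<in>X. 1 / 4 \<le> Im z \<and> Im z \<le> 4 \<and> a \<le> Re z \<and> Re z \<le> b} \<subseteq> {z\<in>X. hq z0 z \<le> K}"
  proof safe
    fix z assume z: "z \<in> X" "1 / 4 \<le> Im z" "Im z \<le> 4" "a \<le> Re z" "Re z \<le> b"
    have "cmod (z0 - z) \<le> \<bar>Re (z0 - z)\<bar> + \<bar>Im (z0 - z)\<bar>" by (rule cmod_le)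
    also have "\<dots> \<le> (\<bar>b - a\<bar> + 4) * Im z0" using z by (simp add: z0_def)
    finally show "hq z0 z \<le> K" unfolding K_def
      using z XH z0 by (intro hq_leI) (auto simp: z0_def)
  qed
  moreover have "finite {z\<in>X. hq z0 z \<le> K}"
    using card_hq_ball[of K] X z0 by (auto simp: K_def)
  ultimately show ?thesis using finite_subset by blast
qed

text \<open>The situation to be refuted. \<open>6400\<close> is the constant of
  \<open>hq_quasi_triangle\<close> for \<open>K = L = 2\<close>, so it bounds \<open>hq\<close>
  between centres of overlapping bumps, as \<open>\<tau> \<le> 2\<close>. \<open>horizontal\<close>
  is the conclusion of \<open>horizontal_extent_of_chain\<close>.\<close>

locale coarse_two_cover =
  fixes X :: "complex set" and U :: "nat \<Rightarrow> complex set set" and N :: real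
  assumes X: "maximal_separated_H2 X"
    and cov: "X = (\<Union>i\<le>1. \<Union>(U i))"
    and sep: "\<And>i Y Y' x y. i \<le> 1 \<Longrightarrow> Y \<in> U i \<Longrightarrow> Y' \<in> U i \<Longrightarrow> x \<in> Y \<Longrightarrow> y \<in> Y' \<Longrightarrow>
      hq x y \<le> 6400 \<Longrightarrow> Y = Y'"
    and N1: "N \<ge> 1"
    and horizontal: "\<And>i W Z x y H. i \<le> 1 \<Longrightarrow> W \<in> U i \<Longrightarrow> Z \<subseteq> W \<Longrightarrow> finite Z \<Longrightarrow> x \<in> Z \<Longrightarrow>
      (x, y) \<in> (chain 6400 Z)\<^sup>* \<Longrightarrow> \<forall>z\<in>Z. Im z \<le> H \<Longrightarrow> \<bar>Re x - Re y\<bar> \<le> N * H"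
begin

definition \<Y> :: "complex set set" where "\<Y> = (\<Union>i\<le>1. U i)"

lemma XH: "X \<subseteq> H2"
  using X by (simp add: maximal_separated_H2_def)

lemma \<Y>_subset: "W \<in> \<Y> \<Longrightarrow> W \<subseteq> X"
  using cov by (auto simp: \<Y>_def)

text \<open>A discrete path inside one piece from a foot \<open>q\<close> near height
  \<open>1\<close> up to height \<open>h\<close>. The path lives in a finite \<open>Z\<close> so
  that \<open>horizontal\<close> applies to its lower part.\<close>

definition leg :: "complex set \<Rightarrow> complex \<Rightarrow> real \<Rightarrow> bool" where
  "leg W q h \<longleftrightarrow> W \<in> \<Y> \<and> q \<in> W \<and> 1 / 4 \<le> Im q \<and> Im q \<le> 4 \<and>
     (\<exists>Z p. finite Z \<and> Z \<subseteq> W \<and> q \<in> Z \<and> (q, p) \<in> (chain 6400 Z)\<^sup>* \<and> h \<le> Im p)"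

definition near :: "nat \<Rightarrow> complex set \<Rightarrow> complex set" where
  "near i B = {x\<in>\<Union>(U i). \<exists>z\<in>B. hq x z < \<tau>}"

text \<open>Continuous in \<open>z\<close> on \<open>H2\<close> and positive there exactly on the
  open unit ball about \<open>x\<close>; by maximality the balls about points of \<open>X\<close>
  cover \<open>H2\<close>.\<close>

definition bump :: "complex \<Rightarrow> complex \<Rightarrow> real" where
  "bump x z = max 0 (\<tau> - hq x z)"

lemma bump_pos_iff: "bump x z > 0 \<longleftrightarrow> hq x z < \<tau>"
  by (auto simp: bump_def)

lemma U_H2: "i \<le> 1 \<Longrightarrow> Y \<in> U i \<Longrightarrow> Y \<subseteq> H2"
  using cov XH by auto

text \<open>Consecutive centres have \<open>hq\<close> at most \<open>6400\<close>, so
  \<open>sep\<close> forces each next centre into the piece of the previous one.\<close>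

lemma overlap_chain:
  assumes i: "i \<le> 1" and B: "B \<subseteq> H2" and x: "x \<in> near i B"
    and ch: "(x, y) \<in> (overlap B bump (near i B))\<^sup>*"
  obtains W where "W \<in> U i" "x \<in> W" "(x, y) \<in> (chain 6400 (near i B \<inter> W))\<^sup>*"
proof -
  obtain W where W: "W \<in> U i" "x \<in> W" using x by (auto simp: near_def)
  have "(x, y) \<in> (chain 6400 (near i B \<inter> W))\<^sup>* \<and> y \<in> W" using ch
  proof induction
    case base
    then show ?case using W by simp
  next
    case (step y w)
    obtain z where z: "z \<in> B" "hq y z < \<tau>" "hq w z < \<tau>" "y \<in> near i B" "w \<in> near i B"
      using step(2) by (auto simp: overlap_def bump_pos_iff)
    obtain W' where W': "W' \<in> U i" "w \<in> W'" using z by (auto simp: near_def)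
    have H: "y \<in> H2" "z \<in> H2" "w \<in> H2" using step(3) W W' z B U_H2[OF i] by auto
    have "hq y w \<le> ((2 + 2) * (2 + 3))\<^sup>2 * ((2 + 2) * (2 + 2))"
      by (rule hq_quasi_triangle[OF H]) (use z \<tau>_bounds hq_commute[of w z] in auto)
    then have yw: "hq y w \<le> 6400" by simp
    then have "W' = W" using sep[OF i W(1) W'(1) _ W'(2)] step(3) by blast
    then have "(y, w) \<in> chain 6400 (near i B \<inter> W)" using W' z step(3) yw by (auto simp: chain_def)
    then show ?case using step(3) W' \<open>W' = W\<close> by (meson rtrancl.rtrancl_into_rtrancl)
  qed
  then show ?thesis using that W by blast
qed

lemma finite_near:
  assumes i: "i \<le> 1" and d: "0 < c"
  shows "finite (near i (rect a b c d))"
proof -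
  define z0 where "z0 = Complex a c"
  define K where "K = ((\<bar>b - a\<bar> + \<bar>d - c\<bar>) / c)\<^sup>2 * 1"
  define K' where "K' = ((K + 2) * (2 + 3))\<^sup>2 * ((K + 2) * (2 + 2))"
  have K: "K \<ge> 0" "K' \<ge> 0" by (auto simp: K_def K'_def)
  have z0: "z0 \<in> H2" using d by (simp add: z0_def H2_def)
  have "near i (rect a b c d) \<subseteq> {x\<in>X. hq z0 x \<le> K'}"
  proof
    fix x assume "x \<in> near i (rect a b c d)"
    then obtain z where x: "x \<in> X" "x \<in> H2" and z: "z \<in> rect a b c d" "hq x z < \<tau>"
      using i cov XH by (auto simp: near_def)
    have zH: "z \<in> H2" using z d by (auto simp: rect_def H2_def)
    have "cmod (z0 - z) \<le> \<bar>Re (z0 - z)\<bar> + \<bar>Im (z0 - z)\<bar>" by (rule cmod_le)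
    also have "\<dots> \<le> (\<bar>b - a\<bar> + \<bar>d - c\<bar>)" using z by (auto simp: z0_def rect_def)
    also have "\<dots> = (\<bar>b - a\<bar> + \<bar>d - c\<bar>) / c * Im z0" using d by (simp add: z0_def)
    finally have "hq z0 z \<le> K" unfolding K_def
      using z by (intro hq_leI z0 zH) (auto simp: z0_def rect_def)
    then have "hq z0 x \<le> K'" unfolding K'_def
      by (rule hq_quasi_triangle[OF z0 zH x(2)]) (use z \<tau>_bounds hq_commute[of x z] in auto)
    then show "x \<in> {x\<in>X. hq z0 x \<le> K'}" using x by simp
  qed
  moreover have "finite {x\<in>X. hq z0 x \<le> K'}"
    using card_hq_ball[OF K(2)] X z0 by blast
  ultimately show ?thesis using finite_subset by blast
qed

lemma continuous_on_bump:
  assumes "x \<in> H2" "B \<subseteq> H2" shows "continuous_on B (bump x)"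
proof -
  have "Im x * Im z \<noteq> 0" if "z \<in> B" for z using assms that H2_Im_pos by fastforce
  then show ?thesis unfolding bump_def hq_def
    by (intro continuous_intros continuous_on_max) auto
qed

text \<open>A left-right crossing by family \<open>0\<close> would be a chain in one piece, below
  height \<open>16 * h\<close> and wider than \<open>N * (16 * h)\<close>. So family
  \<open>1\<close> crosses from bottom to top, and this crossing is the leg.\<close>

lemma exists_leg:
  assumes h: "h \<ge> 1"
  obtains W q where "leg W q h" "a - 4 \<le> Re q" "Re q \<le> a + (16 * N + 40) * h"
proof -
  \<comment> \<open>A horizontal crossing covers \<open>w\<close> up to \<open>4 * (4 * h)\<close>
    at each end, so \<open>w\<close> must exceed \<open>16 * N * h + 32 * h\<close>. The box reaches
    up to \<open>4 * h\<close> because a bump positive there has its centre at height at least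
    \<open>h\<close>.\<close>
  define w where "w = (16 * N + 36) * h"
  define B where "B = rect a (a + w) 1 (4 * h)"
  have w: "w \<ge> 0" using N1 h by (simp add: w_def)
  have BH: "B \<subseteq> H2" by (auto simp: B_def rect_def H2_def)
  have nearH: "near i B \<subseteq> H2" if "i \<le> 1" for i using U_H2[OF that] by (auto simp: near_def)
  have fin: "finite (near i B)" if "i \<le> 1" for i unfolding B_def using that by (rule finite_near) simp
  have close: "\<bar>Re s - Re x\<bar> \<le> 4 * Im s" "Im x \<le> 4 * Im s" "Im s \<le> 4 * Im x"
    if "s \<in> B" "x \<in> H2" "hq x s < \<tau>" for x s
    using hq_Re_le[of s x 2] hq_Im_le[of s x 2] hq_Im_le[of x s 2] that BH \<tau>_bounds hq_commute[of x s]
    by auto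
  have cover: "\<exists>x\<in>near 0 B \<union> near 1 B. bump x z > 0" if z: "z \<in> B" for z
  proof -
    obtain x where x: "x \<in> X" "hq x z < \<tau>" using maximal_hq[OF X, of z] z BH by blast
    then obtain i where i: "i \<le> 1" "x \<in> \<Union>(U i)" using cov by blast
    then have "x \<in> near i B" using x z by (auto simp: near_def)
    moreover have "i = 0 \<or> i = 1" using i by auto
    ultimately show ?thesis using x(2) by (auto simp: bump_pos_iff)
  qed
  have cont: "continuous_on B (bump x)" if "x \<in> near 0 B \<union> near 1 B" for x
    using that nearH[of 0] nearH[of 1] BH by (intro continuous_on_bump) auto
  have "(\<exists>x\<in>near 0 B. \<exists>y\<in>near 0 B. \<exists>s\<in>B. \<exists>t\<in>B. Re s = a \<and> Re t = a + w \<and>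
            bump x s > 0 \<and> bump y t > 0 \<and> (x, y) \<in> (overlap B bump (near 0 B))\<^sup>*) \<or>
         (\<exists>x\<in>near 1 B. \<exists>y\<in>near 1 B. \<exists>s\<in>B. \<exists>t\<in>B. Im s = 1 \<and> Im t = 4 * h \<and>
            bump x s > 0 \<and> bump y t > 0 \<and> (x, y) \<in> (overlap B bump (near 1 B))\<^sup>*)"
    unfolding B_def
    by (rule hex_crossing) (use w h fin cover cont in \<open>auto simp: B_def bump_def\<close>)
  then show ?thesis
  proof (elim disjE bexE conjE)
    fix x y s t assume xy: "x \<in> near 0 B" "y \<in> near 0 B" "s \<in> B" "t \<in> B" "Re s = a" "Re t = a + w"
      "bump x s > 0" "bump y t > 0" "(x, y) \<in> (overlap B bump (near 0 B))\<^sup>*"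
    obtain W where W: "W \<in> U 0" "x \<in> W" "(x, y) \<in> (chain 6400 (near 0 B \<inter> W))\<^sup>*"
      using overlap_chain[of 0 B x y] BH xy by auto
    have top: "Im z \<le> 4 * h" if "z \<in> B" for z using that by (simp add: B_def rect_def)
    have "\<forall>z\<in>near 0 B \<inter> W. Im z \<le> 16 * h"
    proof
      fix z assume "z \<in> near 0 B \<inter> W"
      then obtain v where "v \<in> B" "hq z v < \<tau>" "z \<in> H2" using nearH[of 0] by (auto simp: near_def)
      then show "Im z \<le> 16 * h" using close(2)[of v z] top[of v] by simp
    qed
    then have "\<bar>Re x - Re y\<bar> \<le> N * (16 * h)"
      using W xy fin[of 0] by (intro horizontal[of 0 W "near 0 B \<inter> W"]) auto
    moreover have "\<bar>Re s - Re x\<bar> \<le> 4 * Im s" "\<bar>Re t - Re y\<bar> \<le> 4 * Im t"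
      using close(1)[of s x] close(1)[of t y] xy nearH[of 0] by (auto simp: bump_pos_iff)
    ultimately have "w - 32 * h \<le> 16 * (N * h)" using xy top[of s] top[of t] by auto
    then have False using h by (simp add: w_def algebra_simps)
    then show ?thesis ..
  next
    fix x y s t assume xy: "x \<in> near 1 B" "y \<in> near 1 B" "s \<in> B" "t \<in> B" "Im s = 1" "Im t = 4 * h"
      "bump x s > 0" "bump y t > 0" "(x, y) \<in> (overlap B bump (near 1 B))\<^sup>*"
    obtain W where W: "W \<in> U 1" "x \<in> W" "(x, y) \<in> (chain 6400 (near 1 B \<inter> W))\<^sup>*"
      using overlap_chain[of 1 B x y] BH xy by auto
    have cx: "\<bar>Re s - Re x\<bar> \<le> 4 * Im s" "Im x \<le> 4 * Im s" "Im s \<le> 4 * Im x"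
      using close[of s x] xy nearH[of 1] by (auto simp: bump_pos_iff)
    have "Im t \<le> 4 * Im y" using close(3)[of t y] xy nearH[of 1] by (auto simp: bump_pos_iff)
    then have "h \<le> Im y" using xy by simp
    moreover have "finite (near 1 B \<inter> W) \<and> near 1 B \<inter> W \<subseteq> W \<and> x \<in> near 1 B \<inter> W"
      using fin[of 1] xy W by auto
    ultimately have "\<exists>Z p. finite Z \<and> Z \<subseteq> W \<and> x \<in> Z \<and> (x, p) \<in> (chain 6400 Z)\<^sup>* \<and> h \<le> Im p"
      using W(3) by blast
    moreover have "W \<in> \<Y>" using W by (auto simp: \<Y>_def)
    ultimately have "leg W x h" unfolding leg_def using W cx xy by auto
    moreover have "a \<le> Re s" "Re s \<le> a + w" using xy by (auto simp: B_def rect_def)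
    then have "a - 4 \<le> Re x" "Re x \<le> a + (16 * N + 40) * h"
      using cx xy h by (auto simp: w_def algebra_simps)
    ultimately show ?thesis by (rule that)
  qed
qed

text \<open>Stop the leg at its first point of height at least \<open>t\<close>. The part before
  drifts by at most \<open>N * t\<close>, and the last step, from below \<open>t\<close>, multiplies
  the height by at most \<open>6400 + 2\<close>.\<close>

lemma leg_level:
  assumes leg: "leg W q h" and t: "5 \<le> t" "t \<le> h"
  obtains p where "p \<in> W" "t \<le> Im p" "Im p \<le> 6402 * t" "\<bar>Re p - Re q\<bar> \<le> (N + 6402) * t"
proof -
  obtain Z p where q: "W \<in> \<Y>" "q \<in> W" "Im q \<le> 4"
    and Z: "finite Z" "Z \<subseteq> W" "q \<in> Z" and qp: "(q, p) \<in> (chain 6400 Z)\<^sup>*" "h \<le> Im p"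
    using leg by (auto simp: leg_def)
  have WH: "W \<subseteq> H2" using q \<Y>_subset XH by blast
  define Z' where "Z' = {z\<in>Z. Im z < t}"
  have 1: "Im q < t" "\<not> Im p < t" using q t qp by auto
  obtain z w where zw: "(q, z) \<in> (chain 6400 Z \<inter> {(x, y). Im x < t \<and> Im y < t})\<^sup>*" "Im z < t"
    "(z, w) \<in> chain 6400 Z" "\<not> Im w < t"
    using rtrancl_exit[OF qp(1), of "\<lambda>z. Im z < t"] 1 by metis
  have "chain 6400 Z \<inter> {(x, y). Im x < t \<and> Im y < t} \<subseteq> chain 6400 Z'"
    by (auto simp: chain_def Z'_def)
  then have "(q, z) \<in> (chain 6400 Z')\<^sup>*" using zw(1) rtrancl_mono by blast
  moreover obtain i where "i \<le> 1" "W \<in> U i" using q by (auto simp: \<Y>_def)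
  ultimately have h: "\<bar>Re q - Re z\<bar> \<le> N * t"
    using Z 1 by (intro horizontal[of i W Z']) (auto simp: Z'_def)
  have w: "z \<in> W" "w \<in> W" "hq z w \<le> 6400" using zw Z by (auto simp: chain_def)
  then have "Im w \<le> 6402 * Im z" "\<bar>Re z - Re w\<bar> \<le> 6402 * Im z"
    using hq_Im_le[of z w 6400] hq_Re_le[of z w 6400] WH by auto
  then have "Im w \<le> 6402 * t" "\<bar>Re w - Re q\<bar> \<le> (N + 6402) * t"
    using zw(2) h by (auto simp: algebra_simps)
  then show ?thesis using that[of w] w zw by auto
qed

text \<open>By \<open>leg_level\<close> both legs have a point at height of order \<open>t\<close>
  over a place at distance of order \<open>t\<close> from the foot. In units of \<open>t\<close>
  everything is bounded, so the bound is the same at all scales.\<close>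

lemma legs_close:
  assumes "leg W q h" "leg W' q' t" and t: "5 \<le> t" "t \<le> h" and D: "\<bar>Re q - Re q'\<bar> \<le> D * t"
  obtains p p' where "p \<in> W" "p' \<in> W'" "hq p' p \<le> (D + 2 * (N + 6402) + 6402)\<^sup>2 * 6402"
proof -
  obtain p where p: "p \<in> W" "t \<le> Im p" "Im p \<le> 6402 * t" "\<bar>Re p - Re q\<bar> \<le> (N + 6402) * t"
    using leg_level[OF assms(1) t] by metis
  obtain p' where p': "p' \<in> W'" "t \<le> Im p'" "Im p' \<le> 6402 * t" "\<bar>Re p' - Re q'\<bar> \<le> (N + 6402) * t"
    using leg_level[OF assms(2) t(1)] by auto
  have D0: "D \<ge> 0" using D t by (smt (verit) mult_neg_pos)
  have H: "p' \<in> H2" "p \<in> H2" using p t p' by (auto simp: H2_def)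
  have "cmod (p' - p) \<le> \<bar>Re (p' - p)\<bar> + \<bar>Im (p' - p)\<bar>" by (rule cmod_le)
  also have "\<dots> \<le> (D * t + 2 * ((N + 6402) * t)) + 6402 * t"
    unfolding minus_complex.sel using p p' D t by linarith
  also have "\<dots> = (D + 2 * (N + 6402) + 6402) * t" by (simp add: algebra_simps)
  also have "\<dots> \<le> (D + 2 * (N + 6402) + 6402) * Im p'" using p' N1 D0 by (intro mult_left_mono) auto
  finally show ?thesis using p p' by (intro that[of p p'] hq_leI H) auto
qed

text \<open>Ratio of consecutive scales. The leg sought at scale \<open>t\<close> has its foot
  within \<open>(R - 2) * t\<close> of \<open>q\<close>, its window adds \<open>t\<close>, and one
  more \<open>t\<close> keeps consecutive windows disjoint.\<close>

definition R :: real where "R = 16 * N + 44"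

text \<open>The bound of \<open>legs_close\<close> for \<open>D = R - 2\<close>, converted to a
  distance.\<close>

definition s :: real where
  "s = max 1 (arcosh (1 + ((R - 2) + 2 * (N + 6402) + 6402)\<^sup>2 * 6402 / 2))"

lemma s_ge: "s \<ge> 1"
  by (simp add: s_def)

text \<open>The window extends to the right of \<open>q\<close> only, so that the windows of smaller
  legs nest in it and are disjoint from each other.\<close>

definition floor_points :: "nat \<Rightarrow> complex set \<Rightarrow> complex \<Rightarrow> nat \<Rightarrow> complex set" where
  "floor_points n W q L = {z\<in>iter_nbhd hdist X \<Y> s n W.
     1 / 4 \<le> Im z \<and> Im z \<le> 4 \<and> Re q \<le> Re z \<and> Re z \<le> Re q + 8 * R ^ L}"

lemma finite_floor_points:
  assumes "W \<in> \<Y>" shows "finite (floor_points n W q L)"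
proof (rule finite_subset[OF _ finite_window[OF X]])
  show "floor_points n W q L \<subseteq>
      {z\<in>X. 1 / 4 \<le> Im z \<and> Im z \<le> 4 \<and> Re q \<le> Re z \<and> Re z \<le> Re q + 8 * R ^ L}"
    using iter_nbhd_subset[of \<Y> X W hdist s n] \<Y>_subset assms by (auto simp: floor_points_def)
qed

lemma R_ge: "R \<ge> 60" using N1 by (simp add: R_def)

text \<open>Next to a leg of height \<open>8 * R ^ L\<close> there is, at each of the scales \<open>8 * R ^ l\<close>,
  a leg standing at that distance, and it meets the \<open>s\<close>-neighbourhood of the big leg near its top.\<close>

lemma binomial_le_floor_points:
  "leg W q (8 * R ^ L) \<Longrightarrow> L choose n \<le> card (floor_points n W q L)"
proof (induction n arbitrary: W q L)
  case 0
  have "q \<in> floor_points 0 W q L" using 0 R_ge by (auto simp: floor_points_def leg_def)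
  moreover have "finite (floor_points 0 W q L)" using 0 finite_floor_points by (auto simp: leg_def)
  ultimately show ?case by (simp add: Suc_le_eq card_gt_0_iff) blast
next
  case (Suc n)
  have WY: "W \<in> \<Y>" using Suc(2) by (simp add: leg_def)
  have "\<exists>W' q'. leg W' q' (8 * R ^ l) \<and> Re q + 8 * R ^ l \<le> Re q' \<and>
      Re q' \<le> Re q + (R - 2) * (8 * R ^ l)" for l
  proof -
    define t where "t = 8 * R ^ l"
    have t: "t \<ge> 8" using R_ge one_le_power[of R l] by (simp add: t_def)
    \<comment> \<open>The shift by \<open>t + 4\<close> absorbs the \<open>- 4\<close> of
      \<open>exists_leg\<close>, so the foot stands at least \<open>t\<close> to the right of
      \<open>q\<close>.\<close>
    obtain W' q' where "leg W' q' t" "(Re q + t + 4) - 4 \<le> Re q'"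
       "Re q' \<le> (Re q + t + 4) + (16 * N + 40) * t"
      by (rule exists_leg[of t "Re q + t + 4"]) (use t in auto)
    then show ?thesis using t unfolding t_def[symmetric]
      by (intro exI[of _ W'] exI[of _ q']) (auto simp: R_def algebra_simps)
  qed
  then obtain V v where V: "\<And>l. leg (V l) (v l) (8 * R ^ l)" "\<And>l. Re q + 8 * R ^ l \<le> Re (v l)"
      "\<And>l. Re (v l) \<le> Re q + (R - 2) * (8 * R ^ l)"
    by metis
  have VY: "V l \<in> \<Y>" for l using V(1)[of l] by (simp add: leg_def)
  let ?F = "\<lambda>l. floor_points n (V l) (v l) l"
  have sub: "?F l \<subseteq> floor_points (Suc n) W q L" if l: "l < L" for l
  proof -
    have Rl: "R ^ l \<ge> 1" using R_ge by (intro one_le_power) auto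
    have RL: "R ^ l \<le> R ^ L" "R * R ^ l \<le> R ^ L"
      using R_ge l power_increasing[of l L R] power_increasing[of "Suc l" L R] by auto
    have d: "\<bar>Re q - Re (v l)\<bar> \<le> (R - 2) * (8 * R ^ l)"
      using V(2)[of l] V(3)[of l] Rl by simp
    obtain p p' where p: "p \<in> W" "p' \<in> V l"
       "hq p' p \<le> ((R - 2) + 2 * (N + 6402) + 6402)\<^sup>2 * 6402"
      by (rule legs_close[OF Suc(2) V(1)[of l] _ _ d]) (use Rl RL in auto)
    have H: "p \<in> H2" "p' \<in> H2" "p' \<in> X" using p WY VY[of l] \<Y>_subset XH by blast+
    have "hdist p' p \<le> s" using hdist_le_arcosh[OF H(2,1) p(3)] by (simp add: s_def)
    then have "p' \<in> V l \<inter> nbhd hdist X s W" using p H by (auto simp: nbhd_def)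
    then have "iter_nbhd hdist X \<Y> s n (V l) \<subseteq> iter_nbhd hdist X \<Y> s (Suc n) W"
      by (intro iter_nbhd_Suc_mono VY) auto
    moreover have "Re q \<le> Re (v l)" using V(2)[of l] Rl by simp
    moreover have "Re (v l) + 8 * R ^ l \<le> Re q + 8 * R ^ L"
      using V(3)[of l] RL(2) Rl by (simp add: algebra_simps)
    ultimately show ?thesis unfolding floor_points_def by fastforce
  qed
  have disj: "?F k \<inter> ?F l = {}" if "k < l" for k l
  proof -
    have "R * R ^ k \<le> R ^ l" "R ^ k > 0"
      using R_ge that power_increasing[of "Suc k" l R] by auto
    then have "Re (v k) + 8 * R ^ k < Re (v l)"
      using V(3)[of k] V(2)[of l] by (simp add: algebra_simps)
    then show ?thesis by (force simp: floor_points_def)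
  qed
  \<comment> \<open>The hockey-stick identity matches the decomposition into the disjoint windows of
    the scales \<open>l < L\<close>.\<close>
  have "L choose Suc n = (\<Sum>l<L. l choose n)"
    by (induction L) auto
  also have "\<dots> \<le> (\<Sum>l<L. card (?F l))" using Suc(1) V(1) by (intro sum_mono) auto
  also have "\<dots> = card (\<Union>l<L. ?F l)"
    using finite_floor_points[OF VY] disj
    by (intro card_UN_disjoint[symmetric]) (auto, metis disjoint_iff linorder_neqE_nat)
  also have "\<dots> \<le> card (floor_points (Suc n) W q L)"
    using sub finite_floor_points[OF WY] by (intro card_mono) auto
  finally show ?case .
qed

text \<open>All \<open>L choose (d + 1)\<close> points lie within distance \<open>O(L)\<close> of
  the foot, so growth of degree \<open>d\<close> would bound a polynomial of degree
  \<open>d + 1\<close> in \<open>L\<close> by one of degree \<open>d\<close>.\<close>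

lemma not_poly_growth:
  assumes gr: "uniform_growth_le hdist ((\<lambda>Y. iter_nbhd hdist X \<Y> s (Suc d) Y) ` \<Y>)
    (\<lambda>\<rho>. C * \<rho> ^ d + C)"
  shows False
proof -
  define E where "E = ln 40000 + 2 * ln R"
  have lnR: "ln R \<ge> 0" using R_ge by simp
  have E: "E \<ge> 0" using lnR by (simp add: E_def)
  have bound: "real (L choose Suc d) \<le> \<bar>C\<bar> * ((E * real (L + 1)) ^ d + 1)" for L
  proof -
    have RL: "R ^ L \<ge> 1" using R_ge by (intro one_le_power) auto
    obtain W q where leg: "leg W q (8 * R ^ L)" by (rule exists_leg[of "8 * R ^ L" 0]) (use RL in auto)
    then have W: "W \<in> \<Y>" "q \<in> W" "1 / 4 \<le> Im q" "Im q \<le> 4" by (auto simp: leg_def)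
    define Z where "Z = iter_nbhd hdist X \<Y> s (Suc d) W"
    have ZX: "Z \<subseteq> X" unfolding Z_def using \<Y>_subset W by (intro iter_nbhd_subset) auto
    have qZ: "q \<in> Z" unfolding Z_def
      using iter_nbhd_self[of \<Y> X W hdist s "Suc d"] \<Y>_subset W s_ge by (auto simp del: iter_nbhd.simps)
    \<comment> \<open>Floor points are within Euclidean distance
      \<open>12 * R ^ L \<le> 48 * R ^ L * Im q\<close> of \<open>q\<close>, and heights between
      \<open>1 / 4\<close> and \<open>4\<close> differ by a factor of at most
      \<open>16\<close>.\<close>
    define T where "T = (48 * R ^ L)\<^sup>2 * 16"
    define \<rho> where "\<rho> = ln (2 + T)"
    have T: "T \<ge> 0" by (simp add: T_def)
    have \<rho>: "\<rho> \<ge> 0" using T by (simp add: \<rho>_def)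
    have "2 + T \<le> 40000 * (R ^ L)\<^sup>2"
      using one_le_power[OF RL, of 2] by (simp add: T_def power_mult_distrib)
    then have "\<rho> \<le> ln (40000 * (R ^ L)\<^sup>2)" unfolding \<rho>_def using T by (subst ln_le_cancel_iff) linarith+
    also have "\<dots> = ln 40000 + 2 * (real L * ln R)"
      using R_ge by (simp add: ln_mult ln_realpow)
    also have "\<dots> \<le> E * real (L + 1)"
      using lnR by (simp add: E_def algebra_simps)
    finally have \<rho>E: "\<rho> \<le> E * real (L + 1)" .
    have sub: "floor_points (Suc d) W q L \<subseteq> {z\<in>Z. hdist q z \<le> \<rho>}"
    proof
      fix z assume z: "z \<in> floor_points (Suc d) W q L"
      then have zZ: "z \<in> Z" "1 / 4 \<le> Im z" "Im z \<le> 4" "Re q \<le> Re z" "Re z \<le> Re q + 8 * R ^ L"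
        by (auto simp: floor_points_def Z_def)
      have H: "q \<in> H2" "z \<in> H2" using qZ zZ ZX XH by auto
      have "cmod (q - z) \<le> \<bar>Re (q - z)\<bar> + \<bar>Im (q - z)\<bar>" by (rule cmod_le)
      also have "\<dots> \<le> 12 * R ^ L" using zZ W RL by simp
      also have "\<dots> \<le> 48 * R ^ L * Im q" using W RL by simp
      finally have "hq q z \<le> T" unfolding T_def using zZ W by (intro hq_leI H) auto
      then have "hdist q z \<le> arcosh (1 + T / 2)" using hdist_le_arcosh H by blast
      also have "\<dots> \<le> \<rho>" using arcosh_le_ln[of "1 + T / 2"] T by (simp add: \<rho>_def algebra_simps)
      finally show "z \<in> {z\<in>Z. hdist q z \<le> \<rho>}" using zZ by simp
    qed
    have g: "finite {z\<in>Z. hdist q z \<le> \<rho>}" "real (card {z\<in>Z. hdist q z \<le> \<rho>}) \<le> C * \<rho> ^ d + C"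
      using gr W qZ \<rho> unfolding uniform_growth_le_def Z_def by auto
    have "real (L choose Suc d) \<le> real (card {z\<in>Z. hdist q z \<le> \<rho>})"
      using binomial_le_floor_points[OF leg, of "Suc d"] card_mono[OF g(1) sub] by linarith
    also have "\<dots> \<le> C * (\<rho> ^ d + 1)" using g(2) by (simp add: algebra_simps)
    also have "\<dots> \<le> \<bar>C\<bar> * ((E * real (L + 1)) ^ d + 1)"
      using \<rho>E \<rho> by (intro mult_mono add_mono power_mono) auto
    finally show ?thesis .
  qed
  \<comment> \<open>The two bounds combine to \<open>L ^ (d + 1) \<le> G * L ^ d\<close>, which
    fails once \<open>L > G\<close>.\<close>
  define G where "G = real (Suc d) ^ Suc d * (\<bar>C\<bar> * ((2 * E) ^ d + 1))"
  obtain L :: nat where L: "real L > G" "L \<ge> Suc d"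
    using reals_Archimedean2[of "max G (real (Suc d))"] by (metis max_less_iff_conj of_nat_less_iff less_imp_le)
  have L1: "real L \<ge> 1" using L by simp
  have "(real L / real (Suc d)) ^ Suc d \<le> real (L choose Suc d)"
    by (rule binomial_ge_n_over_k_pow_k[OF L(2)])
  also have "\<dots> \<le> \<bar>C\<bar> * ((E * real (L + 1)) ^ d + 1)" by (rule bound)
  also have "\<dots> \<le> \<bar>C\<bar> * ((E * (2 * real L)) ^ d + real L ^ d)"
    using E L1 by (intro mult_left_mono add_mono power_mono one_le_power) auto
  also have "\<dots> = \<bar>C\<bar> * ((2 * E) ^ d + 1) * real L ^ d"
    by (simp add: power_mult_distrib algebra_simps)
  finally have "real L ^ Suc d \<le> G * real L ^ d"
    by (simp add: power_divide G_def field_simps del: power_Suc)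
  then have "real L \<le> G" using L1 by simp
  then show False using L by simp
qed

end

text \<open>Growth enters twice: for \<open>m = s = 1\<close> it bounds the pieces themselves and
  yields \<open>N\<close>; for \<open>m = d + 1\<close> and the scale \<open>s\<close> computed from
  \<open>N\<close> it is contradicted. This is legitimate because the cover depends on
  \<open>r\<close> only.\<close>

lemma not_asdim_poly_property_1:
  assumes X: "maximal_separated_H2 X"
  shows "\<not> asdim_poly_property hdist X d 1"
proof
  assume P: "asdim_poly_property hdist X d 1"
  have XH: "X \<subseteq> H2" using X by (simp add: maximal_separated_H2_def)
  \<comment> \<open>The extra \<open>1\<close> makes \<open>hq x y \<le> 6400\<close> imply a
    distance strictly below \<open>r\<close>.\<close>
  define r where "r = arcosh (1 + 6400 / 2 :: real) + 1"
  have r: "r \<ge> 0" by (simp add: r_def)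
  obtain U :: "nat \<Rightarrow> complex set set" where cov: "X = (\<Union>i\<le>1. \<Union>(U i))"
    and sep': "\<forall>i\<le>1. \<forall>Y\<in>U i. \<forall>Y'\<in>U i. Y \<noteq> Y' \<longrightarrow>
      Y \<inter> Y' = {} \<and> (\<forall>y\<in>Y. \<forall>y'\<in>Y'. hdist y y' \<ge> r)"
    and gr': "\<forall>m::nat. \<forall>s::real. m \<ge> 1 \<longrightarrow> s \<ge> 1 \<longrightarrow> (\<exists>C::real. uniform_growth_le hdist
      ((\<lambda>Y. iter_nbhd hdist X (\<Union>i\<le>1. U i) s m Y) ` (\<Union>i\<le>1. U i)) (\<lambda>\<rho>. C * \<rho> ^ d + C))"
    using P[unfolded asdim_poly_property_def Let_def, THEN spec, THEN mp, OF r]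
    by (elim exE conjE) (rule that; assumption)
  have sep: "hdist y y' \<ge> r" if "i \<le> 1" "Y \<in> U i" "Y' \<in> U i" "Y \<noteq> Y'" "y \<in> Y" "y' \<in> Y'" for i Y Y' y y'
    using sep' that by meson
  note gr = gr'[THEN spec, THEN spec, THEN mp, THEN mp]
  define \<Y> where "\<Y> = (\<Union>i\<le>1. U i)"
  have sub: "Y \<subseteq> X" if "Y \<in> \<Y>" for Y using that cov by (auto simp: \<Y>_def)
  obtain C where C: "uniform_growth_le hdist ((\<lambda>Y. iter_nbhd hdist X \<Y> 1 1 Y) ` \<Y>) (\<lambda>\<rho>. C * \<rho> ^ d + C)"
    using gr[of 1 1] by (auto simp: \<Y>_def)
  obtain A where A: "A \<ge> 0" "\<And>W. W \<subseteq> H2 \<Longrightarrow> \<forall>x\<in>W. \<forall>\<rho>\<ge>0. finite {z\<in>W. hdist x z \<le> \<rho>} \<and>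
    real (card {z\<in>W. hdist x z \<le> \<rho>}) \<le> C * \<rho> ^ d + C \<Longrightarrow> growth4 A W"
    by (rule poly_growth_imp_growth4[of C d]) (rule that; blast)
  have g4: "growth4 A Y" if Y: "Y \<in> \<Y>" for Y
  proof (intro A(2) ballI allI impI)
    show "Y \<subseteq> H2" using sub[OF Y] XH by blast
    fix x and \<rho> :: real assume x: "x \<in> Y" and \<rho>: "\<rho> \<ge> 0"
    define Z where "Z = iter_nbhd hdist X \<Y> 1 1 Y"
    have YZ: "Y \<subseteq> Z" unfolding Z_def using sub Y by (intro iter_nbhd_self) auto
    then have "finite {z\<in>Z. hdist x z \<le> \<rho>}" "real (card {z\<in>Z. hdist x z \<le> \<rho>}) \<le> C * \<rho> ^ d + C"
      using C Y x \<rho> unfolding uniform_growth_le_def Z_def by blast+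
    moreover have "{z\<in>Y. hdist x z \<le> \<rho>} \<subseteq> {z\<in>Z. hdist x z \<le> \<rho>}" using YZ by blast
    ultimately show "finite {z\<in>Y. hdist x z \<le> \<rho>} \<and> real (card {z\<in>Y. hdist x z \<le> \<rho>}) \<le> C * \<rho> ^ d + C"
      by (meson card_mono finite_subset of_nat_mono order_trans)
  qed
  obtain N where N: "N \<ge> 1" "\<And>W Z x y H. growth4 A W \<Longrightarrow> Z \<subseteq> W \<Longrightarrow> finite Z \<Longrightarrow> x \<in> Z \<Longrightarrow>
    (x, y) \<in> (chain 6400 Z)\<^sup>* \<Longrightarrow> \<forall>z\<in>Z. Im z \<le> H \<Longrightarrow> \<bar>Re x - Re y\<bar> \<le> N * H"
    by (rule horizontal_extent_of_chain[OF A(1) zero_le_numeral]) (rule that; blast)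
  interpret coarse_two_cover X U N
  proof
    fix i Y Y' x y assume i: "i \<le> (1::nat)" "Y \<in> U i" "Y' \<in> U i" "x \<in> Y" "y \<in> Y'" "hq x y \<le> 6400"
    then have "x \<in> H2" "y \<in> H2" using cov XH by auto
    then have "hdist x y < r" using hdist_le_arcosh[of x y 6400] i by (simp add: r_def)
    then show "Y = Y'" using sep[of i Y Y' x y] i by force
  next
    fix i W Z x y H assume "i \<le> (1::nat)" "W \<in> U i" "Z \<subseteq> W" "finite Z" "x \<in> Z"
      "(x, y) \<in> (chain 6400 Z)\<^sup>*" "\<forall>z\<in>Z. Im z \<le> H"
    then show "\<bar>Re x - Re y\<bar> \<le> N * H" using g4[of W] by (intro N(2)[of W]) (auto simp: \<Y>_def)
  qed (use X cov N in auto)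
  show False using gr[of "Suc d" s] s_ge not_poly_growth unfolding \<Y>_def by auto
qed

text \<open>An additional empty family changes neither the union nor the collection of
  pieces.\<close>

lemma asdim_poly_property_Suc:
  assumes "asdim_poly_property \<delta> X d n"
  shows "asdim_poly_property \<delta> X d (Suc n)"
  unfolding asdim_poly_property_def
proof (intro allI impI)
  fix r :: real assume r: "r \<ge> 0"
  obtain U :: "nat \<Rightarrow> 'a set set" where U: "X = (\<Union>i\<le>n. \<Union>(U i))"
       "\<forall>i\<le>n. \<forall>Y\<in>U i. \<forall>Y'\<in>U i. Y \<noteq> Y' \<longrightarrow>
           Y \<inter> Y' = {} \<and> (\<forall>y\<in>Y. \<forall>y'\<in>Y'. \<delta> y y' \<ge> r)"
       "let \<Y> = (\<Union>i\<le>n. U i) in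
         \<forall>m::nat. \<forall>s::real. m \<ge> 1 \<longrightarrow> s \<ge> 1 \<longrightarrow>
           (\<exists>C::real. uniform_growth_le \<delta> ((\<lambda>Y. iter_nbhd \<delta> X \<Y> s m Y) ` \<Y>)
                        (\<lambda>\<rho>. C * \<rho> ^ d + C))"
    using assms[unfolded asdim_poly_property_def, THEN spec, THEN mp, OF r]
    by (elim exE conjE) (rule that; assumption)
  define V where "V = U(Suc n := {})"
  have V: "(\<Union>i\<le>Suc n. V i) = (\<Union>i\<le>n. U i)" "(\<Union>i\<le>Suc n. \<Union>(V i)) = (\<Union>i\<le>n. \<Union>(U i))"
  proof -
    have "{..n} \<inter> {x. x \<noteq> Suc n} = {..n}" by auto
    then show "(\<Union>i\<le>Suc n. V i) = (\<Union>i\<le>n. U i)" "(\<Union>i\<le>Suc n. \<Union>(V i)) = (\<Union>i\<le>n. \<Union>(U i))"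
      by (simp_all add: V_def atMost_Suc)
  qed
  show "\<exists>U. X = (\<Union>i\<le>Suc n. \<Union>(U i)) \<and>
       (\<forall>i\<le>Suc n. \<forall>Y\<in>U i. \<forall>Y'\<in>U i. Y \<noteq> Y' \<longrightarrow>
           Y \<inter> Y' = {} \<and> (\<forall>y\<in>Y. \<forall>y'\<in>Y'. \<delta> y y' \<ge> r)) \<and>
       (let \<Y> = (\<Union>i\<le>Suc n. U i) in
         \<forall>m::nat. \<forall>s::real. m \<ge> 1 \<longrightarrow> s \<ge> 1 \<longrightarrow>
           (\<exists>C::real. uniform_growth_le \<delta> ((\<lambda>Y. iter_nbhd \<delta> X \<Y> s m Y) ` \<Y>)
                        (\<lambda>\<rho>. C * \<rho> ^ d + C)))"
  proof (rule exI[of _ V], unfold V, intro conjI)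
    have "V i = {} \<or> i \<le> n \<and> V i = U i" if "i \<le> Suc n" for i
      using that by (auto simp: V_def)
    then show "\<forall>i\<le>Suc n. \<forall>Y\<in>V i. \<forall>Y'\<in>V i. Y \<noteq> Y' \<longrightarrow>
           Y \<inter> Y' = {} \<and> (\<forall>y\<in>Y. \<forall>y'\<in>Y'. \<delta> y y' \<ge> r)"
      using U(2) by (metis empty_iff)
  qed (use U in auto)
qed

section \<open>Upper bound\<close>

text \<open>Each iteration moves by at most \<open>s\<close> and then across one piece, hence two
  uses of \<open>hq_quasi_triangle\<close> per step.\<close>

lemma iter_nbhd_bounded:
  assumes X: "X \<subseteq> H2" and sub: "\<And>Y. Y \<in> \<Y> \<Longrightarrow> Y \<subseteq> X" and s: "s \<ge> 0"
    and D: "\<And>Y x y. Y \<in> \<Y> \<Longrightarrow> x \<in> Y \<Longrightarrow> y \<in> Y \<Longrightarrow> hq x y \<le> D"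
  shows "\<exists>K. \<forall>Y\<in>\<Y>. \<forall>z\<in>iter_nbhd hdist X \<Y> s m Y. \<exists>y\<in>Y. hq y z \<le> K"
proof (induction m)
  case 0
  have "\<exists>y\<in>Y. hq y z \<le> 0" if "z \<in> iter_nbhd hdist X \<Y> s 0 Y" for Y z
    using that by (intro bexI[of _ z]) auto
  then show ?case by blast
next
  case (Suc m)
  then obtain K where K: "\<And>Y z. Y \<in> \<Y> \<Longrightarrow> z \<in> iter_nbhd hdist X \<Y> s m Y \<Longrightarrow> \<exists>y\<in>Y. hq y z \<le> K"
    by blast
  define S where "S = 2 * (cosh s - 1)"
  define K1 where "K1 = ((K + 2) * (S + 3))\<^sup>2 * ((K + 2) * (S + 2))"
  define K2 where "K2 = ((K1 + 2) * (D + 3))\<^sup>2 * ((K1 + 2) * (D + 2))"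
  have "\<exists>y\<in>Y. hq y z \<le> K2" if Y: "Y \<in> \<Y>" and z: "z \<in> iter_nbhd hdist X \<Y> s (Suc m) Y" for Y z
  proof -
    obtain Y' u v where Y': "Y' \<in> \<Y>" "z \<in> Y'" "u \<in> Y'" "u \<in> X"
      "v \<in> iter_nbhd hdist X \<Y> s m Y" "hdist u v \<le> s"
      using z by (auto simp: nbhd_def)
    have v: "v \<in> X" using Y' Y sub by (cases m) auto
    obtain y where y: "y \<in> Y" "hq y v \<le> K" using K[OF Y Y'(5)] by blast
    have H: "y \<in> H2" "v \<in> H2" "u \<in> H2" "z \<in> H2" using y Y sub Y' X v by blast+
    have "hq v u \<le> S" using Y'(6) H s by (simp add: S_def hdist_le_iff hq_commute[of v u])
    then have "hq y u \<le> K1" unfolding K1_def by (rule hq_quasi_triangle[OF H(1-3) y(2)])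
    then have "hq y z \<le> K2" unfolding K2_def
      by (rule hq_quasi_triangle[OF H(1,3,4)]) (use D Y' in auto)
    then show ?thesis using y by blast
  qed
  then show ?case by blast
qed

text \<open>The neighbourhoods have uniformly bounded diameter, so \<open>card_hq_ball\<close>
  bounds their cardinality by one \<open>M\<close>, whatever \<open>d\<close> is.\<close>

lemma uniform_growth_of_bounded_pieces:
  assumes X: "maximal_separated_H2 X" and sub: "\<And>Y. Y \<in> \<Y> \<Longrightarrow> Y \<subseteq> X" and s: "s \<ge> 0"
    and D: "\<And>Y x y. Y \<in> \<Y> \<Longrightarrow> x \<in> Y \<Longrightarrow> y \<in> Y \<Longrightarrow> hq x y \<le> D"
  shows "\<exists>C. uniform_growth_le hdist ((\<lambda>Y. iter_nbhd hdist X \<Y> s m Y) ` \<Y>) (\<lambda>\<rho>. C * \<rho> ^ d + C)"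
proof -
  have XH: "X \<subseteq> H2" using X by (simp add: maximal_separated_H2_def)
  have "\<exists>K. \<forall>Y\<in>\<Y>. \<forall>z\<in>iter_nbhd hdist X \<Y> s m Y. \<exists>y\<in>Y. hq y z \<le> K"
    by (rule iter_nbhd_bounded[OF XH sub s D])
  then obtain K where K: "\<And>Y z. Y \<in> \<Y> \<Longrightarrow> z \<in> iter_nbhd hdist X \<Y> s m Y \<Longrightarrow> \<exists>y\<in>Y. hq y z \<le> K"
    by blast
  define K1 where "K1 = ((K + 2) * (D + 3))\<^sup>2 * ((K + 2) * (D + 2))"
  define K2 where "K2 = ((K1 + 2) * (K + 3))\<^sup>2 * ((K1 + 2) * (K + 2))"
  obtain M where M: "\<And>z. z \<in> H2 \<Longrightarrow> finite {x\<in>X. hq z x \<le> max 0 K2} \<and> card {x\<in>X. hq z x \<le> max 0 K2} \<le> M"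
    using card_hq_ball[of "max 0 K2"] X by auto
  have "uniform_growth_le hdist ((\<lambda>Y. iter_nbhd hdist X \<Y> s m Y) ` \<Y>) (\<lambda>\<rho>. real M * \<rho> ^ d + real M)"
    unfolding uniform_growth_le_def
  proof (intro ballI allI impI)
    fix Z x and \<rho> :: real
    assume Z: "Z \<in> (\<lambda>Y. iter_nbhd hdist X \<Y> s m Y) ` \<Y>" and x: "x \<in> Z" and \<rho>: "0 \<le> \<rho>"
    then obtain Y where Y: "Y \<in> \<Y>" "Z = iter_nbhd hdist X \<Y> s m Y" by blast
    have ZX: "Z \<subseteq> X" using Y sub by (cases m) auto
    obtain y where y: "y \<in> Y" "hq y x \<le> K" using K Y x by blast
    have H: "x \<in> H2" "y \<in> H2" using x ZX XH y Y sub by blast+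
    have "hq x z \<le> K2" if z: "z \<in> Z" for z
    proof -
      obtain y' where y': "y' \<in> Y" "hq y' z \<le> K" using K Y z by blast
      have H': "y' \<in> H2" "z \<in> H2" using z ZX XH y' Y sub by blast+
      have "hq x y' \<le> K1" unfolding K1_def
        by (rule hq_quasi_triangle[OF H H'(1)]) (use y y' Y D hq_commute[of x y] in auto)
      then show ?thesis unfolding K2_def
        by (rule hq_quasi_triangle[OF H(1) H' _ y'(2)])
    qed
    then have "{z\<in>Z. hdist x z \<le> \<rho>} \<subseteq> {z\<in>X. hq x z \<le> max 0 K2}" using ZX by force
    moreover have "real M \<le> real M * \<rho> ^ d + real M" using \<rho> by simp
    ultimately show "finite {z\<in>Z. hdist x z \<le> \<rho>} \<and> real (card {z\<in>Z. hdist x z \<le> \<rho>}) \<le> real M * \<rho> ^ d + real M"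
      using M[OF H(1)] by (meson card_mono finite_subset of_nat_mono order_trans)
  qed
  then show ?thesis by blast
qed

section \<open>The brick tiling and its three separated families\<close>

definition close :: "real \<Rightarrow> complex \<Rightarrow> complex \<Rightarrow> bool" where
  "close g z w \<longleftrightarrow> Im z \<le> g * Im w \<and> Im w \<le> g * Im z \<and>
     \<bar>Re z - Re w\<bar> \<le> g * Im z \<and> \<bar>Re z - Re w\<bar> \<le> g * Im w"

lemma close_sym: "close g z w \<Longrightarrow> close g w z"
  by (auto simp: close_def)

lemma hdist_less_imp_close:
  assumes "z \<in> H2" "w \<in> H2" "hdist z w < r" "0 \<le> r"
  shows "close (exp r + 2) z w"
proof -
  have "hq z w \<le> 2 * (cosh r - 1)" using assms hdist_le_iff[of z w r] by auto
  also have "\<dots> = exp r + exp (- r) - 2" by (simp add: cosh_field_def field_simps)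
  also have "\<dots> \<le> exp r"
  proof -
    have "exp (- r) \<le> 1" using assms(4) by simp
    then show ?thesis by linarith
  qed
  finally have hq: "hq z w \<le> exp r" .
  then show ?thesis unfolding close_def
    using hq_Im_le[of z w] hq_Im_le[of w z] hq_Re_le[of z w] hq_Re_le[of w z] assms hq_commute[of z w]
      abs_minus_commute[of "Re z" "Re w"] by auto
qed

text \<open>\<open>g\<close> is the factor of \<open>close\<close> and \<open>n\<close> the height
  ratio of consecutive lines. A band spans a factor \<open>g^2\<close>, so
  \<open>n \<ge> g^3\<close> leaves a factor \<open>g\<close> between one band and the next.\<close>

locale brick_tiling =
  fixes g :: real and n :: nat
  assumes g: "g \<ge> 3" and n: "g ^ 3 \<le> real n"
begin

text \<open>Level \<open>j\<close> of the tiling has its horizontal line at height \<open>pw j\<close>; bands surround these lines.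
  On the grid of mesh \<open>w * pw j\<close>, tubes surround the vertical walls that hang below the line (in
  the core \<open>j - 1\<close>) and, as the walls above stand on a multiple of this grid, also all
  vertices on the line (in the band \<open>j\<close>).\<close>

definition pw :: "int \<Rightarrow> real" where "pw j = real n powi j"

text \<open>Half-widths and mesh in units of \<open>P = pw j\<close>. Close points below height
  \<open>g * P\<close> differ by less than \<open>g * g * P\<close> in real part, which is the
  margin to keep. \<open>\<delta>\<^sub>b\<close> adds it to the half-width
  \<open>\<delta>\<^sub>c * real n\<close> of the walls above the line; \<open>w\<close> leaves it
  between tubes.\<close>

definition \<delta>\<^sub>c :: real where "\<delta>\<^sub>c = g * g"
definition \<delta>\<^sub>b :: real where "\<delta>\<^sub>b = \<delta>\<^sub>c * real n + g * g"
definition w :: real where "w = 2 * \<delta>\<^sub>b + g * g"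

definition band :: "int \<Rightarrow> complex set" where
  "band j = {z. pw j / g \<le> Im z \<and> Im z < g * pw j}"

definition core :: "int \<Rightarrow> complex set" where
  "core j = {z. g * pw j \<le> Im z \<and> Im z < pw (j + 1) / g}"

definition tube :: "real \<Rightarrow> real \<Rightarrow> int \<Rightarrow> complex set" where
  "tube P \<delta> k = {z. \<bar>Re z - w * P * k\<bar> < \<delta> * P}"

definition gap :: "real \<Rightarrow> real \<Rightarrow> int \<Rightarrow> complex set" where
  "gap P \<delta> k = {z. w * P * k + \<delta> * P \<le> Re z \<and> Re z \<le> w * P * (k + 1) - \<delta> * P}"

lemma n_bounds: "real n \<ge> 27" "real n \<ge> g" "real n \<ge> g * g" "real n \<ge> g * g * g"
proof -
  have "g * g * g \<le> real n" using n by (simp add: power3_eq_cube)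
  moreover have "3 * 3 \<le> g * g" using g by (intro mult_mono) auto
  moreover from this have "(3 * 3) * 3 \<le> g * g * g" "g * 1 \<le> g * g" "g * g * 1 \<le> g * g * g"
    using g by (intro mult_mono, auto)+
  ultimately show "real n \<ge> 27" "real n \<ge> g" "real n \<ge> g * g" "real n \<ge> g * g * g" by linarith+
qed

lemma pw_pos [simp]: "pw j > 0"
  using n_bounds by (simp add: pw_def)

lemma pw_Suc: "pw (j + 1) = real n * pw j"
  using n_bounds by (simp add: pw_def power_int_add mult.commute)

lemma pw_less: "i < j \<Longrightarrow> real n * pw i \<le> pw j"
  using n_bounds power_int_increasing[of "i + 1" j "real n"] pw_Suc[of i] by (simp add: pw_def)

lemma params: "\<delta>\<^sub>c > 0" "2 * \<delta>\<^sub>c \<ge> g * g" "\<delta>\<^sub>b - \<delta>\<^sub>c \<ge> g * g" "\<delta>\<^sub>b - \<delta>\<^sub>c * real n \<ge> g * g" "2 * \<delta>\<^sub>b \<ge> g * g"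
  "w - 2 * \<delta>\<^sub>b \<ge> g * g" "w - 2 * \<delta>\<^sub>c \<ge> g * g" "\<delta>\<^sub>b > 0" "w > 0"
proof -
  have gg: "g * g > 0" using g by simp
  have "\<delta>\<^sub>c * 1 \<le> \<delta>\<^sub>c * real n" using gg n_bounds by (intro mult_left_mono) (auto simp: \<delta>\<^sub>c_def)
  then show "\<delta>\<^sub>c > 0" "2 * \<delta>\<^sub>c \<ge> g * g" "\<delta>\<^sub>b - \<delta>\<^sub>c \<ge> g * g" "\<delta>\<^sub>b - \<delta>\<^sub>c * real n \<ge> g * g" "2 * \<delta>\<^sub>b \<ge> g * g"
    "w - 2 * \<delta>\<^sub>b \<ge> g * g" "w - 2 * \<delta>\<^sub>c \<ge> g * g" "\<delta>\<^sub>b > 0" "w > 0"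
    using gg by (auto simp: \<delta>\<^sub>b_def w_def \<delta>\<^sub>c_def)
qed

lemma band_unique:
  assumes "z \<in> band i" "v \<in> band j" "close g z v" shows "i = j"
proof -
  have False if "i < j" "z \<in> band i" "v \<in> band j" "close g z v" for i j z v
  proof -
    have "g * Im z < g * (g * pw i)" using that g by (simp add: band_def)
    also have "\<dots> = (g * g * g) * pw i / g" using g by simp
    also have "\<dots> \<le> real n * pw i / g" using n_bounds g by (intro divide_right_mono mult_right_mono) (auto simp: less_imp_le)
    also have "\<dots> \<le> pw j / g" using pw_less[OF that(1)] g by (intro divide_right_mono) auto
    also have "\<dots> \<le> Im v" using that by (simp add: band_def)
    finally show False using that by (simp add: close_def)
  qed
  then show ?thesis using assms close_sym by (metis linorder_neqE)
qed

lemma core_unique: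
  assumes "z \<in> core i" "v \<in> core j" "close g z v" shows "i = j"
proof -
  have False if "i < j" "z \<in> core i" "v \<in> core j" "close g z v" for i j z v
  proof -
    have "g * Im z < g * (pw (i + 1) / g)" using that g by (intro mult_strict_left_mono) (auto simp: core_def)
    also have "\<dots> = 1 * pw (i + 1)" using g by simp
    also have "\<dots> \<le> g * pw j"
      using pw_less[OF that(1)] pw_Suc[of i] g by (intro mult_mono) (auto simp: less_imp_le)
    also have "\<dots> \<le> Im v" using that by (simp add: core_def)
    finally show False using that by (simp add: close_def)
  qed
  then show ?thesis using assms close_sym by (metis linorder_neqE)
qed

lemma band_core:
  assumes z: "z \<in> band j" and v: "v \<in> core i" and c: "close g z v"
  shows "i = j \<or> i + 1 = j"
proof (rule ccontr)
  assume neq: "\<not> ?thesis"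
  show False
  proof (cases "i > j")
    case True
    have "g * Im z < g * (g * pw j)" using z g by (simp add: band_def)
    also have "\<dots> \<le> g * (real n * pw j)" using n_bounds g by (intro mult_left_mono mult_right_mono) (auto simp: less_imp_le)
    also have "\<dots> \<le> g * pw i" using pw_less[OF True] g by (intro mult_left_mono) auto
    also have "\<dots> \<le> Im v" using v by (simp add: core_def)
    finally show False using c by (simp add: close_def)
  next
    case False
    then have "i + 1 < j" using neq by auto
    have "g * Im v < g * (pw (i + 1) / g)" using v g by (intro mult_strict_left_mono) (auto simp: core_def)
    also have "\<dots> = g * pw (i + 1) / g" by simp
    also have "\<dots> \<le> real n * pw (i + 1) / g" using n_bounds g by (intro divide_right_mono mult_right_mono) (auto simp: less_imp_le)
    also have "\<dots> \<le> pw j / g" using pw_less[OF \<open>i + 1 < j\<close>] g by (intro divide_right_mono) auto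
    also have "\<dots> \<le> Im z" using z by (simp add: band_def)
    finally show False using c by (simp add: close_def)
  qed
qed

lemma close_Re_less:
  assumes "close g z v" "Im z < g * P" shows "\<bar>Re z - Re v\<bar> < g * g * P"
proof -
  have "\<bar>Re z - Re v\<bar> \<le> g * Im z" using assms by (simp add: close_def)
  also have "\<dots> < g * (g * P)" using assms g by (intro mult_strict_left_mono) auto
  finally show ?thesis by simp
qed

text \<open>A gap of width \<open>(w - 2 * \<delta>) * P\<close> separates neighbouring tubes;
  dually, in \<open>gap_unique\<close>, a tube of width \<open>2 * \<delta> * P\<close> separates
  neighbouring gaps.\<close>

lemma tube_unique:
  assumes "z \<in> tube P \<delta> k" "v \<in> tube P \<delta> l" "\<bar>Re z - Re v\<bar> < g * g * P" "P > 0" "w - 2 * \<delta> \<ge> g * g"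
  shows "k = l"
proof (rule ccontr)
  assume "k \<noteq> l"
  then have "1 \<le> \<bar>real_of_int k - real_of_int l\<bar>" by linarith
  then have "w * P * 1 \<le> w * P * \<bar>real_of_int k - real_of_int l\<bar>"
    using params assms by (intro mult_left_mono) auto
  also have "\<dots> = \<bar>w * P * k - w * P * l\<bar>" using params assms by (simp add: abs_mult flip: right_diff_distrib)
  also have "\<dots> < \<delta> * P + \<delta> * P + g * g * P" using assms(1-3) unfolding tube_def mem_Collect_eq by linarith
  finally have "(w - 2 * \<delta>) * P < g * g * P" by (simp add: algebra_simps)
  then show False using assms by simp
qed

lemma gap_unique:
  assumes "z \<in> gap P \<delta> k" "v \<in> gap P \<delta> l" "\<bar>Re z - Re v\<bar> < g * g * P" "P > 0" "2 * \<delta> \<ge> g * g"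
  shows "k = l"
proof -
  have False if kl: "k < l" and "z \<in> gap P \<delta> k" "v \<in> gap P \<delta> l" "\<bar>Re z - Re v\<bar> < g * g * P" for k l z v
  proof -
    have "w * P * (real_of_int k + 1) \<le> w * P * real_of_int l"
      using params assms kl by (intro mult_left_mono) auto
    then have "2 * \<delta> * P \<le> Re v - Re z" using that by (auto simp: gap_def)
    moreover have "g * g * P \<le> 2 * \<delta> * P" using assms by (intro mult_right_mono) auto
    ultimately show False using that by linarith
  qed
  then show ?thesis using assms by (metis abs_minus_commute linorder_neqE)
qed

lemma gap_avoids_grid:
  assumes z: "z \<in> gap P \<delta> k" and v: "\<bar>Re v - w * P * real_of_int l\<bar> < \<epsilon> * P"
    and c: "\<bar>Re z - Re v\<bar> < g * g * P" and P: "P > 0" and \<delta>: "\<delta> - \<epsilon> \<ge> g * g"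
  shows False
proof -
  have "\<delta> * P \<le> \<bar>Re z - w * P * l\<bar>"
  proof (cases "l \<le> k")
    case True
    then have "w * P * l \<le> w * P * k" using params P by (intro mult_left_mono) auto
    then show ?thesis using z by (auto simp: gap_def)
  next
    case False
    then have "w * P * (real_of_int k + 1) \<le> w * P * l" using params P by (intro mult_left_mono) auto
    then show ?thesis using z by (auto simp: gap_def)
  qed
  then have "(\<delta> - \<epsilon>) * P < g * g * P" using v c by (simp add: algebra_simps)
  then show False using \<delta> P by simp
qed

lemma tube_or_gap:
  assumes "P > 0"
  shows "\<exists>k. z \<in> tube P \<delta> k \<or> z \<in> gap P \<delta> k"
proof -
  define k where "k = \<lfloor>Re z / (w * P)\<rfloor>"
  have wP: "w * P > 0" using params assms by simp
  have "real_of_int k \<le> Re z / (w * P)" "Re z / (w * P) < real_of_int k + 1" by (auto simp: k_def)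
  then have k: "w * P * k \<le> Re z" "Re z < w * P * (k + 1)"
    using wP by (simp_all add: le_divide_eq divide_less_eq mult.commute)
  consider "Re z < w * P * k + \<delta> * P" | "Re z > w * P * (k + 1) - \<delta> * P"
    | "w * P * k + \<delta> * P \<le> Re z" "Re z \<le> w * P * (k + 1) - \<delta> * P" by linarith
  then show ?thesis
  proof cases
    case 1
    then have "z \<in> tube P \<delta> k" using k by (simp add: tube_def)
    then show ?thesis by blast
  next
    case 2
    then have "z \<in> tube P \<delta> (k + 1)" using k by (simp add: tube_def)
    then show ?thesis by blast
  next
    case 3
    then have "z \<in> gap P \<delta> k" by (simp add: gap_def)
    then show ?thesis by blast
  qed
qed

lemma band_or_core:
  assumes "z \<in> H2"
  shows "\<exists>j. z \<in> band j \<or> z \<in> core j"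
proof -
  have z: "Im z > 0" using assms H2_Im_pos by auto
  have n1: "real n > 1" using n_bounds by simp
  \<comment> \<open>The factor \<open>g\<close> places \<open>z\<close> between the bottom
    \<open>pw j / g\<close> of band \<open>j\<close> and the bottom of band
    \<open>j + 1\<close>.\<close>
  define j where "j = \<lfloor>log n (g * Im z)\<rfloor>"
  have gz: "g * Im z > 0" using z g by simp
  have "real n powr real_of_int j \<le> g * Im z" "g * Im z < real n powr real_of_int (j + 1)"
    using n1 gz by (auto simp: j_def powr_le_iff less_powr_iff)
  moreover have "real n powr real_of_int i = pw i" for i
    using n1 by (simp add: pw_def powr_real_of_int')
  ultimately have "pw j \<le> Im z * g" "Im z * g < pw (j + 1)" by (simp_all only: mult.commute)
  then have j: "pw j / g \<le> Im z" "Im z < pw (j + 1) / g"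
    using g by (simp_all add: divide_le_eq less_divide_eq)
  then show ?thesis by (auto simp: band_def core_def intro!: exI[of _ j])
qed

text \<open>Family \<open>0\<close> holds the vertices, family \<open>1\<close> the horizontal edges
  (band gaps) and the vertical edges (core tubes), family \<open>2\<close> the faces.\<close>

definition brick :: "complex set \<Rightarrow> nat \<Rightarrow> complex set set" where
  "brick X i = (if i = 0 then {X \<inter> band j \<inter> tube (pw j) \<delta>\<^sub>b k | j k. True}
    else if i = 1 then {X \<inter> band j \<inter> gap (pw j) \<delta>\<^sub>b k | j k. True} \<union>
      {X \<inter> core j \<inter> tube (pw (j + 1)) \<delta>\<^sub>c k | j k. True}
    else {X \<inter> core j \<inter> gap (pw (j + 1)) \<delta>\<^sub>c k | j k. True})"

lemma brick_subset: "Y \<in> brick X i \<Longrightarrow> Y \<subseteq> X"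
  by (auto simp: brick_def split: if_splits)

lemma brickI:
  "X \<inter> band j \<inter> tube (pw j) \<delta>\<^sub>b k \<in> brick X 0" "X \<inter> band j \<inter> gap (pw j) \<delta>\<^sub>b k \<in> brick X 1"
  "X \<inter> core j \<inter> tube (pw (j + 1)) \<delta>\<^sub>c k \<in> brick X 1" "X \<inter> core j \<inter> gap (pw (j + 1)) \<delta>\<^sub>c k \<in> brick X 2"
  by (simp_all add: brick_def) blast+

lemma bricks_cover:
  assumes "X \<subseteq> H2" shows "X = (\<Union>i\<le>2. \<Union>(brick X i))"
proof
  show "X \<subseteq> (\<Union>i\<le>2. \<Union>(brick X i))"
  proof
    fix z assume z: "z \<in> X"
    obtain j where j: "z \<in> band j \<or> z \<in> core j" using band_or_core z assms by blast
    obtain k where k: "z \<in> tube (pw j) \<delta>\<^sub>b k \<or> z \<in> gap (pw j) \<delta>\<^sub>b k" using tube_or_gap pw_pos by blast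
    obtain l where l: "z \<in> tube (pw (j + 1)) \<delta>\<^sub>c l \<or> z \<in> gap (pw (j + 1)) \<delta>\<^sub>c l" using tube_or_gap pw_pos by blast
    have "z \<in> \<Union>(brick X 0) \<or> z \<in> \<Union>(brick X 1) \<or> z \<in> \<Union>(brick X 2)"
      using z j k l brickI[of X j k] brickI[of X j l] by blast
    then show "z \<in> (\<Union>i\<le>2. \<Union>(brick X i))" by fastforce
  qed
  show "(\<Union>i\<le>2. \<Union>(brick X i)) \<subseteq> X" using brick_subset by blast
qed

lemma band_Im: "z \<in> band j \<Longrightarrow> Im z < g * pw j"
  by (simp add: band_def)

lemma core_Im:
  assumes "z \<in> core j" shows "Im z < g * pw (j + 1)"
proof -
  have "Im z < pw (j + 1) / g" using assms by (simp add: core_def)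
  also have "\<dots> \<le> pw (j + 1) / 1" using g by (intro divide_left_mono) (auto simp: less_imp_le)
  also have "\<dots> \<le> g * pw (j + 1)" using g by simp
  finally show ?thesis .
qed

text \<open>Separates the two kinds of edges. Only the cores just above and below the band matter. A
  wall above stands on point \<open>n * l\<close> of the grid of line \<open>j\<close> with
  half-width \<open>\<delta>\<^sub>c * real n\<close>, a wall below on point \<open>l\<close> with
  \<open>\<delta>\<^sub>c\<close>; the band gap stays clear of both.\<close>

lemma band_gap_core_tube_not_close:
  assumes z: "z \<in> band j" "z \<in> gap (pw j) \<delta>\<^sub>b k" and v: "v \<in> core i" "v \<in> tube (pw (i + 1)) \<delta>\<^sub>c l"
  shows "\<not> close g z v"
proof
  assume c: "close g z v"
  have d: "\<bar>Re z - Re v\<bar> < g * g * pw j" by (rule close_Re_less[OF c band_Im[OF z(1)]])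
  from band_core[OF z(1) v(1) c] show False
  proof
    assume "i = j"
    then have "\<bar>Re v - w * pw j * real_of_int (int n * l)\<bar> < (\<delta>\<^sub>c * real n) * pw j"
      using v(2) by (simp add: tube_def pw_Suc mult_ac)
    then show False by (rule gap_avoids_grid[OF z(2) _ d pw_pos params(4)])
  next
    assume "i + 1 = j"
    then have "\<bar>Re v - w * pw j * real_of_int l\<bar> < \<delta>\<^sub>c * pw j" using v(2) by (simp add: tube_def)
    then show False by (rule gap_avoids_grid[OF z(2) _ d pw_pos params(3)])
  qed
qed

lemma bricks_separated:
  assumes Y: "Y \<in> brick X i" "Y' \<in> brick X i" and zv: "z \<in> Y" "v \<in> Y'" and c: "close g z v"
  shows "Y = Y'"
proof -
  have bt: "j = j' \<and> k = k'" if "z \<in> band j" "v \<in> band j'" "z \<in> tube (pw j) \<delta>\<^sub>b k" "v \<in> tube (pw j') \<delta>\<^sub>b k'" for j j' k k'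
    using band_unique[OF that(1,2) c] tube_unique[OF that(3)] that(4) close_Re_less[OF c band_Im[OF that(1)]] params by auto
  have bg: "j = j' \<and> k = k'" if "z \<in> band j" "v \<in> band j'" "z \<in> gap (pw j) \<delta>\<^sub>b k" "v \<in> gap (pw j') \<delta>\<^sub>b k'" for j j' k k'
    using band_unique[OF that(1,2) c] gap_unique[OF that(3)] that(4) close_Re_less[OF c band_Im[OF that(1)]] params by auto
  have ct: "j = j' \<and> k = k'" if "z \<in> core j" "v \<in> core j'" "z \<in> tube (pw (j + 1)) \<delta>\<^sub>c k" "v \<in> tube (pw (j' + 1)) \<delta>\<^sub>c k'" for j j' k k'
    using core_unique[OF that(1,2) c] tube_unique[OF that(3)] that(4) close_Re_less[OF c core_Im[OF that(1)]] params by auto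
  have cg: "j = j' \<and> k = k'" if "z \<in> core j" "v \<in> core j'" "z \<in> gap (pw (j + 1)) \<delta>\<^sub>c k" "v \<in> gap (pw (j' + 1)) \<delta>\<^sub>c k'" for j j' k k'
    using core_unique[OF that(1,2) c] gap_unique[OF that(3)] that(4) close_Re_less[OF c core_Im[OF that(1)]] params by auto
  consider "i = 0" | "i = 1" | "i \<noteq> 0" "i \<noteq> 1" by blast
  then show ?thesis
  proof cases
    case 1
    then obtain j k j' k' where "Y = X \<inter> band j \<inter> tube (pw j) \<delta>\<^sub>b k" "Y' = X \<inter> band j' \<inter> tube (pw j') \<delta>\<^sub>b k'"
      using Y by (auto simp: brick_def)
    then show ?thesis using bt[of j j' k k'] zv by auto
  next
    case 3
    then obtain j k j' k' where "Y = X \<inter> core j \<inter> gap (pw (j + 1)) \<delta>\<^sub>c k" "Y' = X \<inter> core j' \<inter> gap (pw (j' + 1)) \<delta>\<^sub>c k'"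
      using Y by (auto simp: brick_def)
    then show ?thesis using cg[of j j' k k'] zv by auto
  next
    case 2
    obtain j k where "Y = X \<inter> band j \<inter> gap (pw j) \<delta>\<^sub>b k \<or> Y = X \<inter> core j \<inter> tube (pw (j + 1)) \<delta>\<^sub>c k"
      using Y(1) 2 by (simp add: brick_def) blast
    moreover obtain j' k' where "Y' = X \<inter> band j' \<inter> gap (pw j') \<delta>\<^sub>b k' \<or> Y' = X \<inter> core j' \<inter> tube (pw (j' + 1)) \<delta>\<^sub>c k'"
      using Y(2) 2 by (simp add: brick_def) blast
    ultimately show ?thesis
      using bg[of j j' k k'] ct[of j j' k k'] zv band_gap_core_tube_not_close[of z j k v j' k']
        band_gap_core_tube_not_close[of v j' k' z j k] c close_sym[OF c]
      by auto
  qed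
qed

text \<open>With \<open>P\<close> the height of the line whose grid is used, a brick has heights
  between \<open>P / (n * g)\<close> and \<open>g * P\<close> and width at most
  \<open>w * P\<close>.\<close>

lemma brick_bounded:
  assumes X: "X \<subseteq> H2" and Y: "Y \<in> brick X i" and zv: "z \<in> Y" "v \<in> Y"
  shows "hq z v \<le> ((w + g) * (real n * g))\<^sup>2 * (g * (real n * g))"
proof -
  have ng: "real n * g > 0" "g > 0" using n_bounds g by auto
  have aux: "hq z v \<le> ((w + g) * (real n * g))\<^sup>2 * (g * (real n * g))"
    if P: "P > 0" and Im: "P \<le> real n * g * Im z" "P \<le> real n * g * Im v" "Im z < g * P" "Im v < g * P"
      and Re: "\<bar>Re z - Re v\<bar> \<le> w * P" for P
  proof (rule hq_leI)
    have i0: "Im z > 0" "Im v > 0" using X brick_subset[OF Y] zv H2_Im_pos by auto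
    have "cmod (z - v) \<le> \<bar>Re (z - v)\<bar> + \<bar>Im (z - v)\<bar>" by (rule cmod_le)
    also have "\<dots> \<le> w * P + g * P" using Re Im i0 by simp
    also have "\<dots> = (w + g) * P" by (simp add: algebra_simps)
    also have "\<dots> \<le> (w + g) * (real n * g * Im z)" using Im params ng by (intro mult_left_mono) auto
    finally show "cmod (z - v) \<le> (w + g) * (real n * g) * Im z" by (simp add: mult.assoc)
    have "Im z \<le> g * P" using Im by simp
    also have "\<dots> \<le> g * (real n * g * Im v)" using Im ng by (intro mult_left_mono) auto
    finally show "Im z \<le> g * (real n * g) * Im v" by (simp add: mult.assoc)
  qed (use X brick_subset[OF Y] zv in auto)
  have band: "pw j \<le> real n * g * Im x" if "x \<in> band j" for x j
  proof -
    have "1 * (pw j / g) \<le> real n * Im x" using that n_bounds g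
      by (intro mult_mono) (auto simp: band_def less_imp_le)
    then show ?thesis using g by (simp add: field_simps)
  qed
  have core: "pw (j + 1) \<le> real n * g * Im x" if "x \<in> core j" for x j
  proof -
    have "g * pw j \<le> Im x" using that by (simp add: core_def)
    moreover have "1 * pw j \<le> g * (g * pw j)" 
      unfolding mult.assoc[symmetric] using params(2) g by (intro mult_right_mono) (auto simp: less_imp_le intro: order_trans[OF _ mult_mono[of 3 g 3 g]])
    ultimately have "pw j \<le> g * Im x" using g by (smt (verit) mult_left_mono)
    then show ?thesis unfolding pw_Suc using n_bounds by (simp add: mult.assoc)
  qed
  have tube: "\<bar>Re z - Re v\<bar> \<le> w * P" if "z \<in> tube P \<delta> k" "v \<in> tube P \<delta> k" "P > 0" "w - 2 * \<delta> \<ge> g * g" for P \<delta> k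
  proof -
    have "2 * \<delta> * P \<le> w * P" using that(3,4) g by (intro mult_right_mono) (use mult_nonneg_nonneg[of g g] in linarith)+
    then show ?thesis using that(1,2) unfolding tube_def mem_Collect_eq by linarith
  qed
  have gap: "\<bar>Re z - Re v\<bar> \<le> w * P" if "z \<in> gap P \<delta> k" "v \<in> gap P \<delta> k" "P > 0" "\<delta> > 0" for P \<delta> k
  proof -
    have "\<delta> * P > 0" using that by simp
    moreover have "w * P * real_of_int (k + 1) = w * P * real_of_int k + w * P" by (simp add: algebra_simps)
    ultimately show ?thesis using that(1,2) unfolding gap_def mem_Collect_eq by linarith
  qed
  obtain j k where jk: "Y = X \<inter> band j \<inter> tube (pw j) \<delta>\<^sub>b k \<or> Y = X \<inter> band j \<inter> gap (pw j) \<delta>\<^sub>b k \<or>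
    Y = X \<inter> core j \<inter> tube (pw (j + 1)) \<delta>\<^sub>c k \<or> Y = X \<inter> core j \<inter> gap (pw (j + 1)) \<delta>\<^sub>c k"
    using Y by (auto simp: brick_def split: if_splits)
  then have "(z \<in> band j \<and> v \<in> band j \<and> \<bar>Re z - Re v\<bar> \<le> w * pw j) \<or>
    (z \<in> core j \<and> v \<in> core j \<and> \<bar>Re z - Re v\<bar> \<le> w * pw (j + 1))"
    using zv tube gap params pw_pos by auto
  then show ?thesis
  proof (elim disjE conjE)
    assume "z \<in> band j" "v \<in> band j" "\<bar>Re z - Re v\<bar> \<le> w * pw j"
    then show ?thesis using band band_Im by (intro aux[of "pw j"]) auto
  next
    assume "z \<in> core j" "v \<in> core j" "\<bar>Re z - Re v\<bar> \<le> w * pw (j + 1)"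
    then show ?thesis using core core_Im by (intro aux[of "pw (j + 1)"]) auto
  qed
qed

end

lemma asdim_poly_property_2:
  assumes X: "maximal_separated_H2 X"
  shows "asdim_poly_property hdist X d 2"
  unfolding asdim_poly_property_def Let_def
proof (intro allI impI)
  fix r :: real assume r: "r \<ge> 0"
  have XH: "X \<subseteq> H2" using X by (simp add: maximal_separated_H2_def)
  define r' where "r' = max r 1"
  \<comment> \<open>The factor that \<open>hdist_less_imp_close\<close> gives for distances below
    \<open>r'\<close>.\<close>
  define g where "g = exp r' + 2"
  define n where "n = nat \<lceil>g ^ 3\<rceil>"
  have r': "r' \<ge> 1" "r' \<ge> r" by (auto simp: r'_def)
  interpret brick_tiling g n
  proof
    have "exp 0 \<le> exp r'" using r' by (subst exp_le_cancel_iff) auto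
    then show "g \<ge> 3" by (simp add: g_def)
    show "g ^ 3 \<le> real n" unfolding n_def by (rule real_nat_ceiling_ge)
  qed
  have far: "Y \<inter> Y' = {} \<and> (\<forall>y\<in>Y. \<forall>y'\<in>Y'. r \<le> hdist y y')"
    if Y: "Y \<in> brick X i" "Y' \<in> brick X i" "Y \<noteq> Y'" for Y Y' i
  proof -
    have sub: "Y \<subseteq> H2" "Y' \<subseteq> H2" using Y XH brick_subset by blast+
    have *: "hdist y y' \<ge> r'" if "y \<in> Y" "y' \<in> Y'" for y y'
    proof (rule ccontr)
      assume "\<not> ?thesis"
      then have "close g y y'" unfolding g_def
        using that sub r' by (intro hdist_less_imp_close) auto
      then show False using bricks_separated[OF Y(1,2) that] Y by blast
    qed
    then show ?thesis using r' by force
  qed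
  show "\<exists>U :: nat \<Rightarrow> complex set set. X = (\<Union>i\<le>2. \<Union>(U i)) \<and>
       (\<forall>i\<le>2. \<forall>Y\<in>U i. \<forall>Y'\<in>U i. Y \<noteq> Y' \<longrightarrow>
           Y \<inter> Y' = {} \<and> (\<forall>y\<in>Y. \<forall>y'\<in>Y'. hdist y y' \<ge> r)) \<and>
       (\<forall>m::nat. \<forall>s::real. m \<ge> 1 \<longrightarrow> s \<ge> 1 \<longrightarrow>
           (\<exists>C::real. uniform_growth_le hdist
              ((\<lambda>Y. iter_nbhd hdist X (\<Union>i\<le>2. U i) s m Y) ` (\<Union>i\<le>2. U i)) (\<lambda>\<rho>. C * \<rho> ^ d + C)))"
  proof (intro exI[of _ "brick X"] conjI allI impI ballI)
    show "X = (\<Union>i\<le>2. \<Union>(brick X i))" by (rule bricks_cover[OF XH])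
    fix m :: nat and s :: real assume s: "s \<ge> 1"
    show "\<exists>C. uniform_growth_le hdist
      ((\<lambda>Y. iter_nbhd hdist X (\<Union>i\<le>2. brick X i) s m Y) ` (\<Union>i\<le>2. brick X i)) (\<lambda>\<rho>. C * \<rho> ^ d + C)"
    proof (rule uniform_growth_of_bounded_pieces[OF X])
      show "Y \<subseteq> X" if "Y \<in> (\<Union>i\<le>2. brick X i)" for Y
        using that brick_subset by blast
      show "hq x y \<le> ((w + g) * (real n * g))\<^sup>2 * (g * (real n * g))"
        if "Y \<in> (\<Union>i\<le>2. brick X i)" "x \<in> Y" "y \<in> Y" for Y x y
        using that brick_bounded[OF XH] by blast
    qed (use s in simp)
  qed (use far in blast)+
qed

theorem theoremF:
  fixes X :: "complex set" and d :: nat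
  assumes "maximal_separated_H2 X"
  shows "asdim_poly hdist X d = 2"
  unfolding asdim_poly_def
proof (rule Least_equality)
  show "asdim_poly_property hdist X d 2" by (rule asdim_poly_property_2[OF assms])
  fix n assume n: "asdim_poly_property hdist X d n"
  show "2 \<le> n"
  proof (rule ccontr)
    assume "\<not> 2 \<le> n"
    then have "n = 0 \<or> n = 1" by auto
    \<comment> \<open>By monotonicity in the number of families, excluding \<open>1\<close> also
      excludes \<open>0\<close>.\<close>
    then have "asdim_poly_property hdist X d 1"
      using n asdim_poly_property_Suc[of hdist X d 0] by auto
    then show False using not_asdim_poly_property_1[OF assms] by blast
  qed
qed

end
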